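(* Let $y$ be a positive integer and let $E_{y-1}$ be the event that an infinite half-plane walk has a cut at level $y-1$. If the measure $Q^\infty$ on infinite half-plane SAWs is conditioned on $E_{y-1}$ and only the walk up to height $y$ (i.e. the initial segment of the walk up to its first visit to $\{z:\mathrm{Im}(z)=y\}$) is considered, then the resulting probability measure is $\mathbf Q^y$. That is, for every SAW $\omega$ from $0$ to a point with imaginary part $y$ whose intermediate vertices all lie in $\{z:0<\mathrm{Im}(z)<y\}$, the conditional $Q^\infty$-probability given $E_{y-1}$ that the walk up to height $y$ equals $\omega$ is $\mathbf Q^y(\omega)$.
   Context: Write $\mathbb Z^2=\mathbb Z+i\mathbb Z\subset\mathbb C$. A self-avoiding walk (SAW) is a finite nearest-neighbor path $\omega=[\omega_0,\ldots,\omega_n]$ in $\mathbb Z^2$ with distinct vertices; $|\omega|=n$ is its number of steps, and $0$-step walks are allowed. If $C_n$ is the number of $n$-step SAWs with $\omega_0=0$, then $\beta_c$ is defined by $1/\beta_c=\lim_n C_n^{1/n}$ (so $0<\beta_c<1$). Concatenation: if $\omega^1=[\omega^1_0,\ldots,\omega^1_m]$ and $\omega^2=[0,\omega^2_1,\omega^2_2,\ldots]$ (finite or infinite), then $\omega^1\otimes\omega^2=[\omega^1_0,\ldots,\omega^1_m,\omega^1_m+\omega^2_1,\omega^1_m+\omega^2_2,\ldots]$; iterated concatenations are defined similarly. A half-plane SAW is a SAW $\omega=[\omega_0=0,\ldots,\omega_n]$ with $\mathrm{Im}[\omega_j]>0$ for all $j>0$ (including $[0]$); its height is $h(\omega)=\max_j\mathrm{Im}[\omega_j]$.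 Infinite half-plane SAWs are defined in the same way, with infinitely many steps. A bridge is a finite half-plane SAW $\omega=[\omega_0=0,\ldots,\omega_n]$ with $\mathrm{Im}[\omega_n]=h(\omega)$ (the trivial walk $[0]$ is a bridge of height $0$). An irreducible bridge is a bridge of height $\ge1$ which cannot be written as $\omega^1\otimes\omega^2$ with $\omega^1,\omega^2$ bridges of height $\ge1$; $\mathcal I$ is the set of irreducible bridges. It is a known fact (Kesten) that $\sum_{\omega\in\mathcal I}\beta_c^{|\omega|}=1$. $Q$ is the probability measure on $\mathcal I$ with $Q(\omega)=\beta_c^{|\omega|}$. $Q^\infty$ is the infinite product measure on $\mathcal I\times\mathcal I\times\cdots$, regarded as a probability measure on infinite half-plane SAWs via $(\omega^1,\omega^2,\ldots)\mapsto\omega^1\otimes\omega^2\otimes\cdots$. An infinite half-plane walk $\omega$ has a cut at level $k$ if $\omega=\omega^1\otimes\omega^2$ where $\omega^1$ is a bridge of height $k$ and $\omega^2$ is an infinite half-plane SAW (started at $0$). $\mathbf Q^y$ is the probability measure on the set of SAWs $\omega$ that start at $0$, end at some point $z\in\mathbb Z^2$ with $\mathrm{Im}[z]=y$, and in between stay in the strip $\{z:0<\mathrm{Im}(z)<y\}$, given by $\mathbf Q^y(\omega)=\beta_c^{|\omega|}/Z$, where $Z$ is the sum of $\beta_c^{|\omega|}$ over all such walks (it is known that $Z<\infty$). *)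

theory Defs
  imports "HOL-Probability.Probability"
begin

text \<open>
  The lattice \<open>\<int> + i\<int>\<close> is the type \<open>int \<times> int\<close>; the imaginary part of a vertex is its second
  component. Finite walks are non-empty vertex lists, infinite walks are functions on \<open>nat\<close>.
\<close>

type_synonym vertex = "int \<times> int"
type_synonym walk = "vertex list"

definition nearest_neighbors :: "vertex \<Rightarrow> vertex \<Rightarrow> bool" where
  "nearest_neighbors u v \<longleftrightarrow> \<bar>fst u - fst v\<bar> + \<bar>snd u - snd v\<bar> = 1"

definition is_SAW :: "walk \<Rightarrow> bool" where
  "is_SAW \<omega> \<longleftrightarrow> \<omega> \<noteq> [] \<and> successively nearest_neighbors \<omega> \<and> distinct \<omega>"

definition steps :: "walk \<Rightarrow> nat" where
  "steps \<omega> = length \<omega> - 1"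

definition SAW_count :: "nat \<Rightarrow> nat" where
  "SAW_count n = card {\<omega>. is_SAW \<omega> \<and> hd \<omega> = 0 \<and> steps \<omega> = n}"

definition beta_c :: real where
  "beta_c = 1 / lim (\<lambda>n. root n (real (SAW_count n)))"

definition concat_walk :: "walk \<Rightarrow> walk \<Rightarrow> walk" (infixl "\<otimes>" 65) where
  "\<omega>1 \<otimes> \<omega>2 = \<omega>1 @ map (\<lambda>z. last \<omega>1 + z) (tl \<omega>2)"

definition concat_inf :: "walk \<Rightarrow> (nat \<Rightarrow> vertex) \<Rightarrow> nat \<Rightarrow> vertex" where
  "concat_inf \<omega>1 w n = (if n \<le> steps \<omega>1 then \<omega>1 ! n else last \<omega>1 + w (n - steps \<omega>1))"

primrec iter_concat :: "(nat \<Rightarrow> walk) \<Rightarrow> nat \<Rightarrow> walk" where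
  "iter_concat \<omega>s 0 = [0]"
| "iter_concat \<omega>s (Suc k) = iter_concat \<omega>s k \<otimes> \<omega>s k"

text \<open>
  Intended for sequences of walks that start at \<open>0\<close> and have at least one step each (such as
  irreducible bridges): then the concatenation of the first \<open>n\<close> walks has at least \<open>n\<close> steps,
  so it already contains the \<open>n\<close>-th vertex of the infinite concatenation.
\<close>

definition infinite_concat :: "(nat \<Rightarrow> walk) \<Rightarrow> nat \<Rightarrow> vertex" where
  "infinite_concat \<omega>s n = iter_concat \<omega>s n ! n"

definition half_plane_SAW :: "walk \<Rightarrow> bool" where
  "half_plane_SAW \<omega> \<longleftrightarrow> is_SAW \<omega> \<and> hd \<omega> = 0 \<and> (\<forall>j\<in>{0<..steps \<omega>}. snd (\<omega> ! j) > 0)"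

definition inf_half_plane_SAW :: "(nat \<Rightarrow> vertex) \<Rightarrow> bool" where
  "inf_half_plane_SAW w \<longleftrightarrow>
     (\<forall>n. nearest_neighbors (w n) (w (Suc n))) \<and> inj w \<and> w 0 = 0 \<and> (\<forall>j>0. snd (w j) > 0)"

definition height :: "walk \<Rightarrow> int" where
  "height \<omega> = Max (snd ` set \<omega>)"

definition bridge :: "walk \<Rightarrow> bool" where
  "bridge \<omega> \<longleftrightarrow> half_plane_SAW \<omega> \<and> snd (last \<omega>) = height \<omega>"

definition irreducible_bridge :: "walk \<Rightarrow> bool" where
  "irreducible_bridge \<omega> \<longleftrightarrow> bridge \<omega> \<and> height \<omega> \<ge> 1 \<and>
     \<not> (\<exists>\<omega>1 \<omega>2. bridge \<omega>1 \<and> height \<omega>1 \<ge> 1 \<and> bridge \<omega>2 \<and> height \<omega>2 \<ge> 1 \<and> \<omega> = \<omega>1 \<otimes> \<omega>2)"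

text \<open>The measure \<open>Q\<close>; that its total mass is 1 is Kesten's theorem.\<close>

definition Q_measure :: "walk measure" where
  "Q_measure = point_measure {\<omega>. irreducible_bridge \<omega>} (\<lambda>\<omega>. ennreal (beta_c ^ steps \<omega>))"

definition inf_half_plane_space :: "(nat \<Rightarrow> vertex) measure" where
  "inf_half_plane_space =
     restrict_space (\<Pi>\<^sub>M n\<in>UNIV. count_space UNIV) {w. inf_half_plane_SAW w}"

definition Q_inf :: "(nat \<Rightarrow> vertex) measure" where
  "Q_inf = distr (\<Pi>\<^sub>M n\<in>UNIV. Q_measure) inf_half_plane_space infinite_concat"

definition has_cut :: "int \<Rightarrow> (nat \<Rightarrow> vertex) \<Rightarrow> bool" where
  "has_cut k w \<longleftrightarrow>
     (\<exists>\<omega>1 w2. bridge \<omega>1 \<and> height \<omega>1 = k \<and> inf_half_plane_SAW w2 \<and> w = concat_inf \<omega>1 w2)"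

definition cut_event :: "int \<Rightarrow> (nat \<Rightarrow> vertex) set" where
  "cut_event k = {w \<in> space Q_inf. has_cut k w}"

text \<open>
  The value is meaningful only for walks that visit height \<open>y\<close>; the walks that do not
  form a \<open>Q_inf\<close>-null set.
\<close>

definition walk_up_to :: "int \<Rightarrow> (nat \<Rightarrow> vertex) \<Rightarrow> walk" where
  "walk_up_to y w = map w [0..<Suc (LEAST n. snd (w n) = y)]"

definition strip_SAWs :: "int \<Rightarrow> walk set" where
  "strip_SAWs y = {\<omega>. is_SAW \<omega> \<and> hd \<omega> = 0 \<and> snd (last \<omega>) = y \<and>
     (\<forall>j\<in>{0<..<steps \<omega>}. 0 < snd (\<omega> ! j) \<and> snd (\<omega> ! j) < y)}"

definition Z_strip :: "int \<Rightarrow> real" where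
  "Z_strip y = (\<Sum>\<^sub>\<infinity>\<omega>\<in>strip_SAWs y. beta_c ^ steps \<omega>)"

definition Q_strip :: "int \<Rightarrow> walk measure" where
  "Q_strip y = point_measure (strip_SAWs y) (\<lambda>\<omega>. ennreal (beta_c ^ steps \<omega> / Z_strip y))"

end

theory Submission imports Defs begin

text \<open>
  The statement has two parts: that \<open>Q_measure\<close> is a probability measure, which is Kesten's
  identity, and the identification of the conditional law.

  For the second part, bridges factor uniquely into irreducible bridges (\<open>bridge_factorization\<close>,
  \<open>concat_list_inject\<close>), and an infinite concatenation of irreducible bridges has cuts only between
  its factors (\<open>cut_at_infinite_concat_iff\<close>). So the infinite walk has a cut whose lower part is
  a given bridge \<open>\<rho>\<close> precisely if the sequence of factors starts with the factorization of \<open>\<rho>\<close>, and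
  this has probability \<open>beta_c ^ steps \<rho>\<close> (\<open>emeasure_cut_at_event\<close>). Above such a cut at level
  \<open>y - 1\<close> the walk must step up, so the walk up to height \<open>y\<close> is \<open>\<rho>\<close> followed by one step up. The walks
  of this form, with \<open>\<rho>\<close> a bridge of height \<open>y - 1\<close>, are exactly the walks across the strip. Hence the
  conditional probability of such a walk is proportional to \<open>beta_c\<close> to the number of its steps, and
  the normalizing constants agree because both laws are probability measures; the constant
  \<open>Z_strip y\<close> is \<open>beta_c\<close> times the probability of the cut event, and therefore finite.

  For Kesten's identity, let \<open>B(z)\<close> and \<open>I(z)\<close> be the generating functions of bridges and of
  irreducible bridges, so that \<open>B(z)\<close> is the sum of the powers of \<open>I(z)\<close>. By Fekete's lemma the
  generating function of all walks is finite below \<open>beta_c\<close> and infinite at \<open>beta_c\<close>. The finiteness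
  forces \<open>I(z) \<le> 1\<close> below \<open>beta_c\<close>, hence at \<open>beta_c\<close>. The Hammersley--Welsh argument decomposes a
  walk into two half-plane walks, and a half-plane walk into bridges of decreasing heights; this
  bounds the generating function of all walks in terms of \<open>exp (B(z))\<close>
  (\<open>half_plane_weight_finite\<close>, \<open>SAWs_weight_le\<close>). So \<open>B(beta_c)\<close> is infinite, which is impossible
  if \<open>I(beta_c) < 1\<close>.
\<close>

section \<open>Concatenation of walks\<close>

text \<open>
  Under \<open>\<otimes>\<close>, the walks from the origin form a cancellative monoid with unit
  \<open>[0]\<close>; the first vertex of the second factor is identified with the last one of the first.
\<close>

definition from_origin :: "walk \<Rightarrow> bool" where
  "from_origin \<omega> \<longleftrightarrow> \<omega> \<noteq> [] \<and> hd \<omega> = 0"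

lemma from_origin_nonempty: "from_origin \<omega> \<Longrightarrow> \<omega> \<noteq> []"
  by (simp add: from_origin_def)

lemma from_origin_Cons [simp]: "from_origin (z # zs) \<longleftrightarrow> z = 0"
  by (simp add: from_origin_def)

lemma from_originE:
  assumes "from_origin \<omega>"
  obtains t where "\<omega> = 0 # t"
  using assms by (cases \<omega>) (auto simp: from_origin_def)

lemma concat_walk_nonempty [simp]: "\<omega>1 \<noteq> [] \<Longrightarrow> \<omega>1 \<otimes> \<omega>2 \<noteq> []"
  by (simp add: concat_walk_def)

lemma from_origin_concat [simp]: "from_origin \<omega>1 \<Longrightarrow> from_origin (\<omega>1 \<otimes> \<omega>2)"
  by (auto simp: from_origin_def concat_walk_def)

lemma steps_concat: "\<omega>1 \<noteq> [] \<Longrightarrow> steps (\<omega>1 \<otimes> \<omega>2) = steps \<omega>1 + steps \<omega>2"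
  by (cases \<omega>1) (auto simp: steps_def concat_walk_def)

lemma last_concat:
  assumes "\<omega>1 \<noteq> []" "from_origin \<omega>2"
  shows "last (\<omega>1 \<otimes> \<omega>2) = last \<omega>1 + last \<omega>2"
  using assms(2) assms(1) by (cases rule: from_originE) (auto simp: concat_walk_def last_map)

lemma set_concat:
  assumes "\<omega>1 \<noteq> []" "from_origin \<omega>2"
  shows "set (\<omega>1 \<otimes> \<omega>2) = set \<omega>1 \<union> (+) (last \<omega>1) ` set \<omega>2"
proof -
  obtain t where "\<omega>2 = 0 # t" using assms(2) by (rule from_originE)
  with assms(1) show ?thesis by (auto simp: concat_walk_def)
qed

lemma concat_walk_assoc:
  assumes "\<omega>1 \<noteq> []" "from_origin \<omega>2"
  shows "(\<omega>1 \<otimes> \<omega>2) \<otimes> \<omega>3 = \<omega>1 \<otimes> (\<omega>2 \<otimes> \<omega>3)"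
proof -
  have "tl (\<omega>2 \<otimes> \<omega>3) = tl \<omega>2 @ map (\<lambda>z. last \<omega>2 + z) (tl \<omega>3)"
    using from_origin_nonempty[OF assms(2)] by (simp add: concat_walk_def)
  then show ?thesis
    using last_concat[OF assms] by (simp add: concat_walk_def[of _ \<omega>3] concat_walk_def[of \<omega>1] add.assoc)
qed

lemma concat_trivial_left [simp]: "from_origin \<omega> \<Longrightarrow> [0] \<otimes> \<omega> = \<omega>"
  by (auto simp: concat_walk_def elim: from_originE)

lemma concat_trivial_right [simp]: "\<omega> \<otimes> [z] = \<omega>"
  by (simp add: concat_walk_def)

lemma trivial_iff_steps_0: "from_origin \<omega> \<Longrightarrow> \<omega> = [0] \<longleftrightarrow> steps \<omega> = 0"
  by (auto simp: steps_def elim!: from_originE)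

text \<open>
  Any cut of the vertex list is a factorization, once the second part is moved back to the
  origin.
\<close>

lemma append_eq_concat:
  assumes "u \<noteq> []"
  shows "u @ zs = u \<otimes> (0 # map (\<lambda>z. z - last u) zs)"
  by (simp add: concat_walk_def comp_def)

lemma concat_left_cancel:
  assumes "\<omega> \<otimes> \<rho> = \<omega> \<otimes> \<rho>'" "from_origin \<rho>" "from_origin \<rho>'"
  shows "\<rho> = \<rho>'"
proof -
  have "inj (\<lambda>z. last \<omega> + z)" by (simp add: inj_on_def)
  then have "tl \<rho> = tl \<rho>'"
    using assms(1) inj_map_eq_map by (force simp: concat_walk_def)
  then show ?thesis using assms(2,3) by (auto elim!: from_originE)
qed

lemma split_walk:
  assumes "from_origin \<omega>" "m \<le> steps \<omega>"
  obtains u v where "\<omega> = u \<otimes> v" "from_origin u" "from_origin v" "steps u = m"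
proof -
  have ne: "\<omega> \<noteq> []" "hd \<omega> = 0" using assms(1) by (auto simp: from_origin_def)
  have "\<omega> = take (Suc m) \<omega> @ drop (Suc m) \<omega>" by simp
  moreover have "take (Suc m) \<omega> \<noteq> []" using ne by simp
  ultimately have "\<omega> = take (Suc m) \<omega> \<otimes> (0 # map (\<lambda>z. z - last (take (Suc m) \<omega>)) (drop (Suc m) \<omega>))"
    using append_eq_concat by metis
  moreover have "from_origin (take (Suc m) \<omega>)" using ne by (cases \<omega>) auto
  moreover have "steps (take (Suc m) \<omega>) = m" using assms(2) ne by (cases \<omega>) (auto simp: steps_def)
  ultimately show thesis using that by fastforce
qed

text \<open>
  Two factorizations of the same walk are initial segments of the same list, so the shorter left
  factor divides the longer one. All statements on uniqueness of factorizations rest on this.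
\<close>

lemma concat_equidivisible:
  assumes eq: "x \<otimes> \<rho> = u \<otimes> \<sigma>" and o: "from_origin x" "from_origin \<rho>" "from_origin u" "from_origin \<sigma>"
    and le: "steps u \<le> steps x"
  obtains v where "from_origin v" "x = u \<otimes> v" "\<sigma> = v \<otimes> \<rho>"
proof -
  obtain u' v where v: "x = u' \<otimes> v" "from_origin u'" "from_origin v" "steps u' = steps u"
    using split_walk[OF o(1) le] by metis
  have "length u' = length u" using v(2,4) o(3) by (auto simp: steps_def elim!: from_originE)
  moreover have "u' \<otimes> (v \<otimes> \<rho>) = u \<otimes> \<sigma>"
    using eq v concat_walk_assoc from_origin_nonempty by metis
  ultimately have "u' = u" by (simp add: concat_walk_def)
  then show thesis
    using that[OF v(3)] v(1) concat_left_cancel[of u "v \<otimes> \<rho>" \<sigma>] o(4) v(3) \<open>u' \<otimes> (v \<otimes> \<rho>) = u \<otimes> \<sigma>\<close>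
    by auto
qed

lemma nearest_neighbors_translate [simp]:
  "nearest_neighbors (a + u) (a + v) = nearest_neighbors u v"
  by (simp add: nearest_neighbors_def)

lemma nearest_neighbors_commute: "nearest_neighbors u v = nearest_neighbors v u"
  by (auto simp: nearest_neighbors_def)

lemma is_SAW_translate: "is_SAW (map (\<lambda>z. a + z) \<omega>) = is_SAW \<omega>"
  by (auto simp: is_SAW_def successively_map distinct_map inj_on_def)

lemma is_SAW_concat_iff:
  assumes "u \<noteq> []" "from_origin v"
  shows "is_SAW (u \<otimes> v) \<longleftrightarrow>
    is_SAW u \<and> is_SAW v \<and> set u \<inter> (\<lambda>z. last u + z) ` set (tl v) = {}"
proof -
  obtain t where t: "v = 0 # t" using assms(2) by (rule from_originE)
  have "successively nearest_neighbors (u \<otimes> v) \<longleftrightarrow>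
      successively nearest_neighbors u \<and>
      successively nearest_neighbors (last u # map (\<lambda>z. last u + z) t)"
    using assms(1) by (cases t) (auto simp: t concat_walk_def successively_append_iff)
  also have "last u # map (\<lambda>z. last u + z) t = map (\<lambda>z. last u + z) v" by (simp add: t)
  also have "successively nearest_neighbors (map (\<lambda>z. last u + z) v) \<longleftrightarrow> successively nearest_neighbors v"
    by (simp add: successively_map)
  finally have s: "successively nearest_neighbors (u \<otimes> v) \<longleftrightarrow>
      successively nearest_neighbors u \<and> successively nearest_neighbors v" .
  have "0 \<notin> set t" if "set u \<inter> (\<lambda>z. last u + z) ` set t = {}"
    using that assms(1) by (metis (no_types, lifting) add.right_neutral disjoint_iff image_eqI last_in_set)
  then have d: "distinct (u \<otimes> v) \<longleftrightarrow>
      distinct u \<and> distinct v \<and> set u \<inter> (\<lambda>z. last u + z) ` set (tl v) = {}"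
    by (auto simp: t concat_walk_def distinct_map)
  have "u \<otimes> v \<noteq> []" "v \<noteq> []" using assms(1) by (simp_all add: t)
  then show ?thesis using assms(1) unfolding is_SAW_def s d by blast
qed

section \<open>Half-plane walks and bridges\<close>

text \<open>
  Quantifying over the set of vertices instead of indices makes half-plane walks and bridges
  directly compatible with \<open>set_concat\<close>.
\<close>

lemma half_plane_SAW_iff:
  "half_plane_SAW \<omega> \<longleftrightarrow> is_SAW \<omega> \<and> from_origin \<omega> \<and> (\<forall>z\<in>set (tl \<omega>). 0 < snd z)"
proof -
  have "(\<forall>j\<in>{0<..steps \<omega>}. 0 < snd (\<omega> ! j)) \<longleftrightarrow> (\<forall>z\<in>set (tl \<omega>). 0 < snd z)" if ne: "\<omega> \<noteq> []"
  proof -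
    obtain x t where t: "\<omega> = x # t" using ne by (cases \<omega>) auto
    have "{0<..steps \<omega>} = Suc ` {..<length t}"
      by (auto simp: t steps_def image_iff intro: gr0_implies_Suc) (metis Suc_le_lessD gr0_implies_Suc lessThan_iff)
    then show ?thesis by (auto simp: t all_set_conv_all_nth)
  qed
  then show ?thesis by (auto simp: half_plane_SAW_def is_SAW_def from_origin_def)
qed

lemma half_plane_SAW_from_origin: "half_plane_SAW \<omega> \<Longrightarrow> from_origin \<omega>"
  by (simp add: half_plane_SAW_iff)

lemma bridge_iff: "bridge \<omega> \<longleftrightarrow> half_plane_SAW \<omega> \<and> (\<forall>z\<in>set \<omega>. snd z \<le> snd (last \<omega>))"
proof -
  have "snd (last \<omega>) = height \<omega> \<longleftrightarrow> (\<forall>z\<in>set \<omega>. snd z \<le> snd (last \<omega>))" if "\<omega> \<noteq> []"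
  proof
    show "\<forall>z\<in>set \<omega>. snd z \<le> snd (last \<omega>)" if "snd (last \<omega>) = height \<omega>"
      using that by (auto simp: height_def)
    show "snd (last \<omega>) = height \<omega>" if "\<forall>z\<in>set \<omega>. snd z \<le> snd (last \<omega>)"
      using that \<open>\<omega> \<noteq> []\<close> unfolding height_def by (intro Max_eqI[symmetric]) auto
  qed
  then show ?thesis by (auto simp: bridge_def half_plane_SAW_iff from_origin_def)
qed

lemma bridge_from_origin: "bridge \<omega> \<Longrightarrow> from_origin \<omega>"
  by (simp add: bridge_iff half_plane_SAW_iff)

lemma bridge_height: "bridge \<omega> \<Longrightarrow> height \<omega> = snd (last \<omega>)"
  by (simp add: bridge_def)

lemma half_plane_SAW_last_pos:
  assumes "half_plane_SAW \<omega>"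
  shows "0 < snd (last \<omega>) \<longleftrightarrow> steps \<omega> \<noteq> 0"
proof -
  obtain t where t: "\<omega> = 0 # t" using assms half_plane_SAW_from_origin from_originE by metis
  show ?thesis using assms by (cases "t = []") (auto simp: t steps_def half_plane_SAW_iff)
qed

lemma bridge_height_pos: "bridge \<omega> \<Longrightarrow> 1 \<le> height \<omega> \<longleftrightarrow> steps \<omega> \<noteq> 0"
  using half_plane_SAW_last_pos by (fastforce simp: bridge_height bridge_iff)

lemma bridge_trivial [simp]: "bridge [0]"
  by (auto simp: bridge_iff half_plane_SAW_iff is_SAW_def)

text \<open>
  A bridge stays weakly below the height of its end point, whereas whatever is appended there
  stays strictly above it, so the two parts cannot meet.
\<close>

lemma half_plane_SAW_concat:
  assumes "bridge u" "half_plane_SAW v"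
  shows "half_plane_SAW (u \<otimes> v)"
proof -
  have o: "from_origin u" "from_origin v"
    using assms half_plane_SAW_from_origin bridge_from_origin by auto
  have "z \<notin> set u" if "z \<in> (\<lambda>z. last u + z) ` set (tl v)" for z
    using that assms by (force simp: bridge_iff half_plane_SAW_iff)
  moreover have "0 \<le> snd (last u)"
    using assms(1) o(1) by (auto simp: bridge_iff elim!: from_originE)
  moreover have "tl (u \<otimes> v) = tl u @ map (\<lambda>z. last u + z) (tl v)"
    using o(1) by (auto simp: concat_walk_def from_origin_def)
  ultimately show ?thesis
    using assms o is_SAW_concat_iff[OF from_origin_nonempty[OF o(1)] o(2)]
    by (auto simp: half_plane_SAW_iff bridge_iff add_nonneg_pos)
qed

lemma bridge_concat:
  assumes "bridge u" "bridge v"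
  shows "bridge (u \<otimes> v)"
proof -
  have o: "from_origin u" "from_origin v"
    using assms bridge_from_origin by auto
  have "0 \<le> snd (last v)"
    using assms(2) o(2) by (auto simp: bridge_iff elim!: from_originE)
  with assms o show ?thesis
    by (fastforce simp: bridge_iff half_plane_SAW_concat set_concat last_concat from_origin_nonempty)
qed

lemma half_plane_SAW_prefix:
  assumes "half_plane_SAW (u \<otimes> v)" "from_origin u" "from_origin v"
  shows "half_plane_SAW u"
  using assms is_SAW_concat_iff[OF from_origin_nonempty[OF assms(2)] assms(3)]
  by (auto simp: half_plane_SAW_iff concat_walk_def from_origin_def)

lemma bridge_suffix:
  assumes "bridge (u \<otimes> v)" "from_origin u" "half_plane_SAW v"
  shows "bridge v"
proof -
  have o: "u \<noteq> []" "from_origin v"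
    using assms half_plane_SAW_from_origin from_origin_nonempty by auto
  have "snd (last u + z) \<le> snd (last u + last v)" if "z \<in> set v" for z
    using assms(1) that unfolding bridge_iff set_concat[OF o] last_concat[OF o] by blast
  then show ?thesis using assms(3) by (simp add: bridge_iff)
qed

section \<open>Unique factorization into irreducible bridges\<close>

abbreviation irreducibles :: "walk set" where
  "irreducibles \<equiv> {\<omega>. irreducible_bridge \<omega>}"

definition concat_list :: "walk list \<Rightarrow> walk" where
  "concat_list \<omega>s = foldr (\<otimes>) \<omega>s [0]"

lemma concat_list_simps [simp]:
  "concat_list [] = [0]" "concat_list (\<omega> # \<omega>s) = \<omega> \<otimes> concat_list \<omega>s"
  by (simp_all add: concat_list_def)

lemma irreducible_bridgeD:
  assumes "irreducible_bridge \<omega>"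
  shows "bridge \<omega>" "from_origin \<omega>" "0 < steps \<omega>"
  using assms bridge_height_pos by (auto simp: irreducible_bridge_def bridge_from_origin)

lemma irreducible_bridge_split:
  assumes "irreducible_bridge (u \<otimes> v)" "bridge u" "bridge v"
  shows "u = [0] \<or> v = [0]"
  using assms bridge_height_pos bridge_from_origin trivial_iff_steps_0
  unfolding irreducible_bridge_def by metis

lemma bridge_concat_list: "set \<omega>s \<subseteq> irreducibles \<Longrightarrow> bridge (concat_list \<omega>s)"
  by (induction \<omega>s) (auto simp: bridge_concat irreducible_bridgeD(1))

lemma concat_list_append:
  "set \<omega>s \<subseteq> irreducibles \<Longrightarrow> set \<rho>s \<subseteq> irreducibles \<Longrightarrow>
    concat_list (\<omega>s @ \<rho>s) = concat_list \<omega>s \<otimes> concat_list \<rho>s"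
proof (induction \<omega>s)
  case (Cons \<omega> \<omega>s)
  then show ?case
    using concat_walk_assoc[of \<omega> "concat_list \<omega>s" "concat_list \<rho>s"] bridge_concat_list[of \<omega>s]
    by (simp add: bridge_from_origin from_origin_nonempty irreducible_bridgeD(2))
qed (simp add: bridge_concat_list bridge_from_origin)

lemma steps_concat_list:
  "set \<omega>s \<subseteq> irreducibles \<Longrightarrow> steps (concat_list \<omega>s) = sum_list (map steps \<omega>s)"
  by (induction \<omega>s) (auto simp: steps_concat irreducible_bridgeD from_origin_nonempty steps_def[of "[0]"])

lemma length_le_steps_concat_list:
  "set \<omega>s \<subseteq> irreducibles \<Longrightarrow> length \<omega>s \<le> steps (concat_list \<omega>s)"
proof (induction \<omega>s)
  case (Cons \<omega> \<omega>s)
  then show ?case using irreducible_bridgeD[of \<omega>] by (simp add: steps_concat from_origin_nonempty)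
qed simp

lemma bridge_factorization:
  assumes "bridge \<omega>"
  obtains \<omega>s where "set \<omega>s \<subseteq> irreducibles" "\<omega> = concat_list \<omega>s"
proof -
  have "\<exists>\<omega>s. set \<omega>s \<subseteq> irreducibles \<and> \<omega> = concat_list \<omega>s"
    using assms
  proof (induction "steps \<omega>" arbitrary: \<omega> rule: less_induct)
    case less
    consider "\<omega> = [0]" | "irreducible_bridge \<omega>" |
      (split) u v where "bridge u" "1 \<le> height u" "bridge v" "1 \<le> height v" "\<omega> = u \<otimes> v"
      using less.prems bridge_height_pos[OF less.prems] trivial_iff_steps_0[OF bridge_from_origin[OF less.prems]]
      unfolding irreducible_bridge_def by metis
    then show ?case
    proof cases
      case 1
      then show ?thesis by (intro exI[of _ "[]"]) simp
    next
      case 2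
      then show ?thesis by (intro exI[of _ "[\<omega>]"]) simp
    next
      case split
      have "steps u < steps \<omega>" "steps v < steps \<omega>"
        using split bridge_height_pos[of u] bridge_height_pos[of v]
        by (auto simp: steps_concat bridge_from_origin from_origin_nonempty)
      then obtain us vs where "set us \<subseteq> irreducibles" "u = concat_list us"
          "set vs \<subseteq> irreducibles" "v = concat_list vs"
        using less.hyps split by metis
      then show ?thesis
        using split by (intro exI[of _ "us @ vs"]) (auto simp: concat_list_append)
    qed
  qed
  then show thesis using that by auto
qed

text \<open>
  An irreducible bridge has no cut strictly inside. So a cut of a product of irreducible bridges
  falls between two factors: if the piece \<open>u\<close> below the cut is not longer than the first factor,
  it divides that factor and hence is trivial or all of it; otherwise the first factor is removed
  from \<open>u\<close>, and the same argument applies to what remains.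
\<close>

lemma cut_of_concat_list:
  assumes "set \<omega>s \<subseteq> irreducibles" "concat_list \<omega>s = u \<otimes> \<rho>" "bridge u" "half_plane_SAW \<rho>"
  shows "\<exists>j\<le>length \<omega>s. u = concat_list (take j \<omega>s)"
  using assms
proof (induction \<omega>s arbitrary: u)
  case Nil
  then have "steps u = 0"
    using steps_concat[OF from_origin_nonempty[OF bridge_from_origin[OF Nil(3)]], of \<rho>]
    by (simp add: steps_def[of "[0]"] flip: Nil(2))
  then have "u = [0]" using trivial_iff_steps_0[OF bridge_from_origin[OF Nil(3)]] by blast
  then show ?case by simp
next
  case (Cons x \<omega>s)
  let ?R = "concat_list \<omega>s"
  have x: "irreducible_bridge x" and R: "bridge ?R"
    using Cons.prems bridge_concat_list by auto
  have o: "from_origin x" "from_origin ?R" "from_origin u" "from_origin \<rho>"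
    using irreducible_bridgeD(2)[OF x] R Cons.prems
    by (auto simp: bridge_from_origin half_plane_SAW_from_origin)
  have eq: "x \<otimes> ?R = u \<otimes> \<rho>" using Cons.prems by simp
  show ?case
  proof (cases "steps u \<le> steps x")
    case True
    obtain v where v: "from_origin v" "x = u \<otimes> v" "\<rho> = v \<otimes> ?R"
      using concat_equidivisible[OF eq o True] .
    have "half_plane_SAW v" using half_plane_SAW_prefix Cons.prems(4) v o by metis
    then have "bridge v" using bridge_suffix irreducible_bridgeD(1)[OF x] v o by metis
    then consider "u = [0]" | "v = [0]" using irreducible_bridge_split x v Cons.prems(3) by blast
    then show ?thesis
    proof cases
      case 1
      then show ?thesis by (intro exI[of _ 0]) simp
    next
      case 2
      then show ?thesis using v by (intro exI[of _ 1]) simp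
    qed
  next
    case False
    then have "steps x \<le> steps u" by simp
    then obtain v where v: "from_origin v" "u = x \<otimes> v" "?R = v \<otimes> \<rho>"
      using concat_equidivisible[OF eq[symmetric] o(3,4,1,2)] by metis
    have "half_plane_SAW v" using half_plane_SAW_prefix R v o by (metis bridge_iff)
    then have "bridge v" using bridge_suffix Cons.prems(3) v o by metis
    then obtain j where "j \<le> length \<omega>s" "v = concat_list (take j \<omega>s)"
      using Cons.IH[of v] Cons.prems v by auto
    then show ?thesis using v by (intro exI[of _ "Suc j"]) simp
  qed
qed

text \<open>
  If the two first factors had different lengths, the shorter one would divide the longer one
  with a non-trivial bridge as quotient, against irreducibility.
\<close>

lemma irreducible_cancel:
  assumes x: "irreducible_bridge x" "irreducible_bridge x'" and R: "bridge R" "bridge R'"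
    and eq: "x \<otimes> R = x' \<otimes> R'"
  shows "x = x' \<and> R = R'"
proof -
  have *: "x = x'" if x: "irreducible_bridge x" "irreducible_bridge x'" and R: "bridge R" "bridge R'"
    and eq: "x \<otimes> R = x' \<otimes> R'" and le: "steps x' \<le> steps x" for x x' R R' :: walk
  proof -
    note o = irreducible_bridgeD(2)[OF x(1)] irreducible_bridgeD(2)[OF x(2)]
      bridge_from_origin[OF R(1)] bridge_from_origin[OF R(2)]
    obtain v where v: "from_origin v" "x = x' \<otimes> v" "R' = v \<otimes> R"
      using concat_equidivisible[OF eq o(1,3,2,4) le] .
    have "half_plane_SAW v" using half_plane_SAW_prefix R v o by (metis bridge_iff)
    then have "bridge v" using bridge_suffix irreducible_bridgeD(1)[OF x(1)] v o by metis
    then have "x' = [0] \<or> v = [0]" using irreducible_bridge_split x v irreducible_bridgeD(1) by blast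
    then show ?thesis using v irreducible_bridgeD(3)[OF x(2)] by (auto simp: steps_def)
  qed
  have "x = x'"
    using *[OF x R eq] *[OF x(2,1) R(2,1) eq[symmetric]] by (metis nle_le)
  then show ?thesis using eq concat_left_cancel bridge_from_origin R by blast
qed

text \<open>
  Together with \<open>bridge_factorization\<close>: the bridges are the free monoid on the irreducible
  bridges.
\<close>

lemma concat_list_inject:
  assumes "set \<omega>s \<subseteq> irreducibles" "set \<rho>s \<subseteq> irreducibles" "concat_list \<omega>s = concat_list \<rho>s"
  shows "\<omega>s = \<rho>s"
  using assms
proof (induction \<omega>s arbitrary: \<rho>s)
  case Nil
  then show ?case using length_le_steps_concat_list[of \<rho>s] by (simp add: steps_def[of "[0]"] flip: Nil(3))
next
  case (Cons \<omega> \<omega>s)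
  show ?case
  proof (cases \<rho>s)
    case Nil
    then show ?thesis using Cons.prems length_le_steps_concat_list[of "\<omega> # \<omega>s"] by (simp add: steps_def)
  next
    case (Cons \<rho> \<rho>s')
    then show ?thesis
      using Cons.IH[of \<rho>s'] Cons.prems irreducible_cancel[of \<omega> \<rho> "concat_list \<omega>s" "concat_list \<rho>s'"]
      by (auto simp: bridge_concat_list)
  qed
qed

section \<open>The connective constant\<close>

abbreviation SAWs :: "walk set" where
  "SAWs \<equiv> {\<omega>. is_SAW \<omega> \<and> hd \<omega> = 0}"

lemma subadditive_iterate:
  fixes u :: "nat \<Rightarrow> real"
  assumes "\<And>m n. u (m + n) \<le> u m + u n"
  shows "u (q * m + r) \<le> real q * u m + u r"
proof (induction q)
  case (Suc q)
  have "u (Suc q * m + r) \<le> u m + u (q * m + r)"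
    using assms[of m "q * m + r"] by (simp add: algebra_simps)
  with Suc show ?case by (simp add: algebra_simps)
qed simp

text \<open>
  Fekete's lemma. Division with remainder by a fixed \<open>m\<close> bounds \<open>u n / n\<close> by \<open>u m / m\<close> plus a
  constant over \<open>n\<close>, and \<open>u m / m\<close> can be chosen close to the infimum.
\<close>

lemma Fekete:
  fixes u :: "nat \<Rightarrow> real"
  assumes sub: "\<And>m n. u (m + n) \<le> u m + u n" and nonneg: "\<And>n. 0 \<le> u n"
  defines "L \<equiv> INF n\<in>{0<..}. u n / real n"
  shows "(\<lambda>n. u n / real n) \<longlonglongrightarrow> L"
    and "\<And>n. real n * L \<le> u n"
proof -
  have bdd: "bdd_below ((\<lambda>n. u n / real n) ` {0<..})"
    using nonneg by (intro bdd_belowI2[of _ 0]) auto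
  have L: "L \<le> u n / real n" if "n > 0" for n
    unfolding L_def using that by (intro cINF_lower[OF bdd]) auto
  show "real n * L \<le> u n" for n
    using L[of n] nonneg[of n] by (cases "n = 0") (auto simp: field_simps)
  show "(\<lambda>n. u n / real n) \<longlonglongrightarrow> L"
  proof (rule LIMSEQ_I)
    fix e :: real assume e: "0 < e"
    have "\<exists>m\<in>{0<..}. u m / real m < L + e / 2"
      using e unfolding L_def
      by (subst cINF_less_iff[OF _ bdd, symmetric]) auto
    then obtain m where m: "m > 0" "u m / real m < L + e / 2" by auto
    define K where "K = Max (u ` {..<m})"
    have K: "u r \<le> K" if "r < m" for r
      unfolding K_def using that by (intro Max_ge) auto
    obtain N where N: "2 * K / e < real N" using reals_Archimedean2 by blast
    have "norm (u n / real n - L) < e" if n: "n \<ge> Suc N" for n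
    proof -
      have "u n \<le> real (n div m) * u m + u (n mod m)"
        using subadditive_iterate[of u "n div m" m "n mod m", OF sub] by simp
      also have "\<dots> \<le> real (n div m) * u m + K" using K m by simp
      also have "real (n div m) * u m \<le> (real n / real m) * u m"
        using of_nat_div_le_of_nat[of n m, where 'a = real] nonneg by (intro mult_right_mono)
      finally have "u n / real n \<le> u m / real m + K / real n"
        using n by (simp add: field_simps)
      moreover have "K / real n < e / 2"
      proof -
        have "2 * K / e < real n" using N n by linarith
        then show ?thesis using n e by (simp add: field_simps)
      qed
      ultimately have "u n / real n < L + e" using m by linarith
      then show ?thesis using L[of n] n e by simp
    qed
    then show "\<exists>N. \<forall>n\<ge>N. norm (u n / real n - L) < e" by blast
  qed
qed

text \<open>
  The straight bridges witness that the number of walks of each length, and the probability of a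
  cut at each level, are positive.
\<close>

definition vertical :: "nat \<Rightarrow> walk" where
  "vertical n = map (\<lambda>k. (0, int k)) [0..<Suc n]"

lemma bridge_vertical: "bridge (vertical n)" "height (vertical n) = int n" "steps (vertical n) = n"
proof -
  have "successively nearest_neighbors (map (\<lambda>k. (0, int k)) [0..<Suc n])"
    by (induction n) (auto simp: successively_append_iff nearest_neighbors_def)
  moreover have "vertical n = 0 # map (\<lambda>k. (0, int k)) [1..<Suc n]"
    by (simp add: vertical_def upt_conv_Cons zero_prod_def del: upt_Suc)
  moreover have "last (vertical n) = (0, int n)" by (simp add: vertical_def)
  moreover have "distinct (vertical n)" by (auto simp: vertical_def distinct_map inj_on_def)
  moreover have "\<forall>z\<in>set (vertical n). snd z \<le> int n" by (auto simp: vertical_def)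
  moreover have "vertical n \<noteq> []" by (simp add: vertical_def)
  ultimately show *: "bridge (vertical n)"
    unfolding bridge_iff half_plane_SAW_iff is_SAW_def by (auto simp del: upt_Suc simp flip: vertical_def)
  show "height (vertical n) = int n"
    using bridge_height[OF *] by (simp add: vertical_def)
  show "steps (vertical n) = n" by (simp add: vertical_def steps_def)
qed

lemma SAWs_from_origin: "\<omega> \<in> SAWs \<longleftrightarrow> is_SAW \<omega> \<and> from_origin \<omega>"
  by (auto simp: is_SAW_def from_origin_def)

lemma half_plane_SAWs_subset: "half_plane_SAW \<omega> \<Longrightarrow> \<omega> \<in> SAWs"
  by (simp add: half_plane_SAW_def)

definition SAWs_of_length :: "nat \<Rightarrow> walk set" where
  "SAWs_of_length n = {\<omega>\<in>SAWs. steps \<omega> = n}"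

lemma SAWs_of_length_add:
  "SAWs_of_length (m + n) \<subseteq> (\<lambda>(u, v). u \<otimes> v) ` (SAWs_of_length m \<times> SAWs_of_length n)"
proof
  fix \<omega> assume \<omega>: "\<omega> \<in> SAWs_of_length (m + n)"
  then have "from_origin \<omega>" "m \<le> steps \<omega>" by (auto simp: SAWs_of_length_def is_SAW_def from_origin_def)
  then obtain u v where uv: "\<omega> = u \<otimes> v" "from_origin u" "from_origin v" "steps u = m"
    by (rule split_walk)
  then have "u \<in> SAWs_of_length m" "v \<in> SAWs_of_length n"
    using \<omega> is_SAW_concat_iff[of u v] from_origin_nonempty[of u]
    by (auto simp: SAWs_of_length_def steps_concat) (auto simp: from_origin_def)
  then show "\<omega> \<in> (\<lambda>(u, v). u \<otimes> v) ` (SAWs_of_length m \<times> SAWs_of_length n)"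
    using uv by blast
qed

lemma finite_SAWs_of_length: "finite (SAWs_of_length n)"
proof (induction n)
  case 0
  have "SAWs_of_length 0 \<subseteq> {[0]}"
    using trivial_iff_steps_0 by (auto simp: SAWs_of_length_def SAWs_from_origin[simplified])
  then show ?case by (rule finite_subset) simp
next
  case (Suc n)
  have "SAWs_of_length 1 \<subseteq> (\<lambda>z. [0, z]) ` ({-1..1} \<times> {-1..1})"
  proof
    fix \<omega> assume \<omega>: "\<omega> \<in> SAWs_of_length 1"
    then obtain z where "\<omega> = [0, z]"
    proof (cases \<omega> rule: remdups_adj.cases)
      case (3 x y xs)
      then show ?thesis using \<omega> that by (simp add: SAWs_of_length_def steps_def)
    qed (auto simp: SAWs_of_length_def is_SAW_def steps_def)
    with \<omega> show "\<omega> \<in> (\<lambda>z. [0, z]) ` ({-1..1} \<times> {-1..1})"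
      by (cases z) (auto simp: SAWs_of_length_def is_SAW_def nearest_neighbors_def intro!: image_eqI[of _ _ z])
  qed
  then have "finite (SAWs_of_length 1)" by (rule finite_subset) simp
  then show ?case
    using SAWs_of_length_add[of n 1] Suc by (auto elim: finite_subset)
qed

lemma SAW_count_eq: "SAW_count n = card (SAWs_of_length n)"
  by (simp add: SAW_count_def SAWs_of_length_def conj_assoc)

lemma SAW_count_pos: "1 \<le> SAW_count n"
proof -
  have "vertical n \<in> SAWs_of_length n"
    using bridge_vertical[of n] by (auto simp: SAWs_of_length_def bridge_iff half_plane_SAW_def)
  then show ?thesis using finite_SAWs_of_length[of n]
    by (auto simp: SAW_count_eq Suc_le_eq card_gt_0_iff)
qed

lemma SAW_count_add: "SAW_count (m + n) \<le> SAW_count m * SAW_count n"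
  using card_mono[OF _ SAWs_of_length_add, of m n]
    card_image_le[of "SAWs_of_length m \<times> SAWs_of_length n" "\<lambda>(u, v). u \<otimes> v"]
  by (simp add: SAW_count_eq finite_SAWs_of_length card_cartesian_product)

text \<open>
  Fekete's lemma for the logarithm of the number of walks. Besides the existence of the limit
  behind \<open>beta_c\<close>, it says that the limit is an infimum; this last inequality is the reason why
  the generating function of all walks diverges at \<open>beta_c\<close> itself.
\<close>

lemma connective_constant:
  shows beta_c_pos: "0 < beta_c"
    and SAW_count_root_tendsto: "(\<lambda>n. root n (real (SAW_count n))) \<longlonglongrightarrow> 1 / beta_c"
    and SAW_count_ge: "1 \<le> real (SAW_count n) * beta_c ^ n"
proof -
  define u where "u n = ln (real (SAW_count n))" for n
  have sub: "u (m + n) \<le> u m + u n" for m n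
  proof -
    have "real (SAW_count (m + n)) \<le> real (SAW_count m) * real (SAW_count n)"
      using SAW_count_add[of m n] by (simp flip: of_nat_mult)
    then have "u (m + n) \<le> ln (real (SAW_count m) * real (SAW_count n))"
      using SAW_count_pos[of "m + n"] unfolding u_def by (intro ln_mono) auto
    also have "\<dots> = u m + u n"
      using SAW_count_pos[of m] SAW_count_pos[of n] by (simp add: u_def ln_mult)
    finally show ?thesis .
  qed
  have nonneg: "0 \<le> u n" for n
    using SAW_count_pos[of n] by (simp add: u_def)
  define L where "L = (INF n\<in>{0<..}. u n / real n)"
  have count: "real (SAW_count n) = exp (u n)" for n
    using SAW_count_pos[of n] by (simp add: u_def)
  have "(\<lambda>n. exp (u n / real n)) \<longlonglongrightarrow> exp L"
    unfolding L_def by (intro tendsto_intros Fekete(1) sub nonneg)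
  moreover have "eventually (\<lambda>n. exp (u n / real n) = root n (real (SAW_count n))) sequentially"
    using eventually_gt_at_top[of 0]
  proof eventually_elim
    case (elim n)
    then have "exp (u n / real n) ^ n = exp (u n)" by (simp flip: exp_of_nat_mult)
    then show ?case using elim by (simp add: count real_root_pos_unique[of n "exp (u n / real n)" "exp (u n)"])
  qed
  ultimately have lim: "(\<lambda>n. root n (real (SAW_count n))) \<longlonglongrightarrow> exp L"
    by (rule Lim_transform_eventually)
  then have b: "beta_c = 1 / exp L"
    by (simp add: beta_c_def limI)
  show "0 < beta_c" unfolding b by simp
  show "(\<lambda>n. root n (real (SAW_count n))) \<longlonglongrightarrow> 1 / beta_c" using lim unfolding b by simp
  have "real n * L \<le> u n" unfolding L_def by (intro Fekete(2) sub nonneg)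
  then have "exp L ^ n \<le> exp (u n)" by (simp flip: exp_of_nat_mult)
  then show "1 \<le> real (SAW_count n) * beta_c ^ n"
    by (simp add: b count power_divide)
qed

section \<open>Generating functions\<close>

text \<open>
  The generating function at \<open>z\<close> of a set of walks, counted by length, is the measure of this set.
  Infinite values are allowed, and rearrangements of series become countable additivity.
\<close>

definition walk_weight :: "real \<Rightarrow> walk measure" where
  "walk_weight z = point_measure UNIV (\<lambda>\<omega>. ennreal (z ^ steps \<omega>))"

lemma walk_weight_space [simp]:
  "space (walk_weight z) = UNIV" "sets (walk_weight z) = UNIV"
  by (simp_all add: walk_weight_def space_point_measure sets_point_measure)

lemma walk_weight_singleton [simp]: "emeasure (walk_weight z) {\<omega>} = ennreal (z ^ steps \<omega>)"
  by (simp add: walk_weight_def emeasure_point_measure_finite2)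

lemma walk_weight_sum:
  "emeasure (walk_weight z) A = (\<integral>\<^sup>+\<omega>. ennreal (z ^ steps \<omega>) \<partial>count_space A)"
  by (subst emeasure_countable_singleton) auto

lemma walk_weight_fixed_length:
  assumes "\<And>\<omega>. \<omega> \<in> A \<Longrightarrow> steps \<omega> = n" "finite A" "0 \<le> z"
  shows "emeasure (walk_weight z) A = ennreal (real (card A) * z ^ n)"
proof -
  have "emeasure (walk_weight z) A = (\<Sum>\<omega>\<in>A. ennreal (z ^ steps \<omega>))"
    using assms by (simp add: walk_weight_def emeasure_point_measure_finite2)
  also have "\<dots> = (\<Sum>\<omega>\<in>A. ennreal (z ^ n))" using assms by (intro sum.cong) auto
  finally show ?thesis using assms by (simp add: ennreal_mult ennreal_of_nat_eq_real_of_nat)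
qed

text \<open>
  If each walk in \<open>A\<close> is determined by a pair in \<open>X \<times> Y\<close>, then \<open>A\<close> embeds into \<open>X \<times> Y\<close>, and the
  generating function of \<open>X \<times> Y\<close> is a product. The exponent \<open>k\<close> counts the steps that the
  decomposition adds.
\<close>

lemma walk_weight_factorization_le:
  assumes z: "0 \<le> z"
    and f: "\<And>\<omega>. \<omega> \<in> A \<Longrightarrow> \<exists>x\<in>X. \<exists>y\<in>Y. \<omega> = f x y \<and> steps \<omega> + k = steps x + steps y"
  shows "ennreal (z ^ k) * emeasure (walk_weight z) A \<le> emeasure (walk_weight z) X * emeasure (walk_weight z) Y"
proof -
  let ?M = "walk_weight z"
  obtain p q where pq: "p \<omega> \<in> X" "q \<omega> \<in> Y" "\<omega> = f (p \<omega>) (q \<omega>)" "steps \<omega> + k = steps (p \<omega>) + steps (q \<omega>)"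
    if "\<omega> \<in> A" for \<omega>
    using f by metis
  define fibre where "fibre x = {\<omega>\<in>A. p \<omega> = x}" for x
  have fibre: "ennreal (z ^ k) * emeasure ?M (fibre x) \<le> ennreal (z ^ steps x) * emeasure ?M Y" for x
  proof -
    have inj: "inj_on q (fibre x)"
    proof (rule inj_onI)
      fix \<omega> \<omega>' assume "\<omega> \<in> fibre x" "\<omega>' \<in> fibre x" "q \<omega> = q \<omega>'"
      then show "\<omega> = \<omega>'" using pq(3)[of \<omega>] pq(3)[of \<omega>'] by (simp add: fibre_def)
    qed
    have "ennreal (z ^ k) * emeasure ?M (fibre x) = (\<integral>\<^sup>+\<omega>. ennreal (z ^ k) * ennreal (z ^ steps \<omega>) \<partial>count_space (fibre x))"
      by (simp add: walk_weight_sum nn_integral_cmult)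
    also have "\<dots> = (\<integral>\<^sup>+\<omega>. ennreal (z ^ steps x) * ennreal (z ^ steps (q \<omega>)) \<partial>count_space (fibre x))"
    proof (intro nn_integral_cong)
      fix \<omega> assume "\<omega> \<in> space (count_space (fibre x))"
      then have "steps \<omega> + k = steps x + steps (q \<omega>)" using pq(4) by (auto simp: fibre_def)
      then show "ennreal (z ^ k) * ennreal (z ^ steps \<omega>) = ennreal (z ^ steps x) * ennreal (z ^ steps (q \<omega>))"
        using z by (simp add: add.commute flip: ennreal_mult power_add)
    qed
    also have "\<dots> = ennreal (z ^ steps x) * (\<integral>\<^sup>+\<omega>. ennreal (z ^ steps (q \<omega>)) \<partial>count_space (fibre x))"
      by (simp add: nn_integral_cmult)
    also have "(\<integral>\<^sup>+\<omega>. ennreal (z ^ steps (q \<omega>)) \<partial>count_space (fibre x)) = emeasure ?M (q ` fibre x)"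
      unfolding walk_weight_sum using inj by (intro nn_integral_bij_count_space) (simp add: bij_betw_def)
    also have "\<dots> \<le> emeasure ?M Y"
      using pq(2) by (intro emeasure_mono) (auto simp: fibre_def)
    finally show ?thesis by (simp add: mult_left_mono)
  qed
  have "A = (\<Union>x\<in>X. fibre x)" using pq(1) by (auto simp: fibre_def)
  then have "emeasure ?M A = emeasure ?M (\<Union>x\<in>X. fibre x)" by simp
  also have "\<dots> = (\<integral>\<^sup>+x. emeasure ?M (fibre x) \<partial>count_space X)"
    by (intro emeasure_UN_countable) (auto simp: disjoint_family_on_def fibre_def)
  finally have "ennreal (z ^ k) * emeasure ?M A = (\<integral>\<^sup>+x. ennreal (z ^ k) * emeasure ?M (fibre x) \<partial>count_space X)"
    by (simp add: nn_integral_cmult)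
  also have "\<dots> \<le> (\<integral>\<^sup>+x. ennreal (z ^ steps x) * emeasure ?M Y \<partial>count_space X)"
    using fibre by (intro nn_integral_mono)
  also have "\<dots> = emeasure ?M X * emeasure ?M Y"
    by (simp add: walk_weight_sum[of z X] nn_integral_multc)
  finally show ?thesis .
qed

text \<open>
  The converse estimate, for which products must determine their factors.
\<close>

lemma walk_weight_product_le:
  assumes z: "0 \<le> z" and inj: "inj_on (\<lambda>(x, y). f x y) (X \<times> Y)"
    and f: "\<And>x y. x \<in> X \<Longrightarrow> y \<in> Y \<Longrightarrow> f x y \<in> A \<and> steps (f x y) = steps x + steps y"
  shows "emeasure (walk_weight z) X * emeasure (walk_weight z) Y \<le> emeasure (walk_weight z) A"
proof -
  let ?M = "walk_weight z"
  have "emeasure ?M X * emeasure ?M Y = (\<integral>\<^sup>+x. ennreal (z ^ steps x) * emeasure ?M Y \<partial>count_space X)"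
    by (simp add: walk_weight_sum[of z X] nn_integral_multc)
  also have "\<dots> = (\<integral>\<^sup>+x. emeasure ?M (f x ` Y) \<partial>count_space X)"
  proof (intro nn_integral_cong)
    fix x assume "x \<in> space (count_space X)"
    then have x: "x \<in> X" by simp
    then have "bij_betw (f x) Y (f x ` Y)"
      using inj by (auto simp: bij_betw_def inj_on_def)
    then have "emeasure ?M (f x ` Y) = (\<integral>\<^sup>+y. ennreal (z ^ steps (f x y)) \<partial>count_space Y)"
      unfolding walk_weight_sum by (rule nn_integral_bij_count_space[symmetric])
    also have "\<dots> = (\<integral>\<^sup>+y. ennreal (z ^ steps x) * ennreal (z ^ steps y) \<partial>count_space Y)"
      using f[OF x] z by (intro nn_integral_cong) (simp add: power_add ennreal_mult)
    finally show "ennreal (z ^ steps x) * emeasure ?M Y = emeasure ?M (f x ` Y)"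
      by (simp add: walk_weight_sum[of z Y] nn_integral_cmult)
  qed
  also have "\<dots> = emeasure ?M (\<Union>x\<in>X. f x ` Y)"
    using inj by (intro emeasure_UN_countable[symmetric]) (auto simp: disjoint_family_on_def inj_on_def)
  also have "\<dots> \<le> emeasure ?M A"
    using f by (intro emeasure_mono) auto
  finally show ?thesis .
qed

text \<open>
  Each length contributes at least \<open>1\<close>.
\<close>

lemma SAWs_weight_critical: "emeasure (walk_weight beta_c) SAWs = \<infinity>"
proof -
  let ?M = "walk_weight beta_c"
  have "of_nat N \<le> emeasure ?M SAWs" for N
  proof -
    have "(of_nat N :: ennreal) = (\<Sum>n<N. 1)" by simp
    also have "\<dots> \<le> (\<Sum>n<N. emeasure ?M (SAWs_of_length n))"
    proof (intro sum_mono)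
      fix n
      show "1 \<le> emeasure ?M (SAWs_of_length n)"
        using walk_weight_fixed_length[of "SAWs_of_length n" n beta_c] finite_SAWs_of_length[of n]
          beta_c_pos SAW_count_ge[of n]
        by (simp add: SAW_count_eq) (simp add: SAWs_of_length_def)
    qed
    also have "\<dots> = emeasure ?M (\<Union>n<N. SAWs_of_length n)"
      by (intro sum_emeasure) (auto simp: disjoint_family_on_def SAWs_of_length_def)
    also have "\<dots> \<le> emeasure ?M SAWs"
      by (intro emeasure_mono) (auto simp: SAWs_of_length_def)
    finally show ?thesis .
  qed
  then have "\<not> emeasure ?M SAWs < \<infinity>"
    using ennreal_Ex_less_of_nat[of "emeasure ?M SAWs"] by (auto simp: not_less[symmetric])
  then show ?thesis by (simp add: less_top[symmetric])
qed

text \<open>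
  The root test, as \<open>1 / beta_c\<close> is the limit of the roots.
\<close>

lemma SAWs_weight_subcritical:
  assumes z: "0 \<le> z" "z < beta_c"
  shows "emeasure (walk_weight z) SAWs < \<infinity>"
proof -
  let ?M = "walk_weight z"
  have "(\<lambda>n. root n (real (SAW_count n)) * z) \<longlonglongrightarrow> 1 / beta_c * z"
    by (intro tendsto_intros SAW_count_root_tendsto)
  moreover have "eventually (\<lambda>n. root n (real (SAW_count n)) * z = root n (norm (real (SAW_count n) * z ^ n))) sequentially"
    using eventually_gt_at_top[of 0]
  proof eventually_elim
    case (elim n)
    have "norm (real (SAW_count n) * z ^ n) = real (SAW_count n) * z ^ n" using z by simp
    then show ?case using elim z by (simp only: real_root_mult real_root_power_cancel)
  qed
  ultimately have "(\<lambda>n. root n (norm (real (SAW_count n) * z ^ n))) \<longlonglongrightarrow> 1 / beta_c * z"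
    by (rule Lim_transform_eventually)
  then have "limsup (\<lambda>n. ereal (root n (norm (real (SAW_count n) * z ^ n)))) = ereal (1 / beta_c * z)"
    by (rule limsup_root_limit')
  then have summable: "summable (\<lambda>n. real (SAW_count n) * z ^ n)"
    using z beta_c_pos by (intro root_test_convergence') (simp add: field_simps)
  have "SAWs = (\<Union>n. SAWs_of_length n)" by (auto simp: SAWs_of_length_def)
  then have "emeasure ?M SAWs = emeasure ?M (\<Union>n. SAWs_of_length n)" by simp
  also have "\<dots> \<le> (\<Sum>n. emeasure ?M (SAWs_of_length n))"
    by (intro emeasure_subadditive_countably) auto
  also have "\<dots> = (\<Sum>n. ennreal (real (SAW_count n) * z ^ n))"
    using walk_weight_fixed_length[of "SAWs_of_length n" n z for n] finite_SAWs_of_length z(1)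
    by (simp add: SAW_count_eq) (simp add: SAWs_of_length_def)
  also have "\<dots> < \<infinity>"
    using z(1) by (subst suminf_ennreal2[OF _ summable]) auto
  finally show ?thesis .
qed

section \<open>The Hammersley--Welsh bound\<close>

lemma split_at_last:
  assumes "from_origin \<omega>" "\<exists>z\<in>set \<omega>. P z"
  obtains u v where "\<omega> = u \<otimes> v" "from_origin u" "from_origin v" "P (last u)"
    "\<And>z. z \<in> set (tl v) \<Longrightarrow> \<not> P (last u + z)"
proof -
  obtain ys x zs where s: "\<omega> = ys @ x # zs" "P x" "\<forall>z\<in>set zs. \<not> P z"
    using split_list_last_prop[OF assms(2)] by blast
  then have "\<omega> = (ys @ [x]) \<otimes> (0 # map (\<lambda>z. z - x) zs)"
    using append_eq_concat[of "ys @ [x]" zs] by simp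
  moreover have "from_origin (ys @ [x])"
    using assms(1) s(1) by (cases ys) auto
  ultimately show thesis
    using s(2,3) by (intro that[of "ys @ [x]" "0 # map (\<lambda>z. z - x) zs"]) auto
qed

definition bridges_of_height :: "nat \<Rightarrow> walk set" where
  "bridges_of_height h = {\<omega>. bridge \<omega> \<and> height \<omega> = int h}"

definition half_plane_upto :: "nat \<Rightarrow> walk set" where
  "half_plane_upto h = {\<omega>. half_plane_SAW \<omega> \<and> (\<forall>z\<in>set \<omega>. snd z \<le> int h)}"

definition reflect :: "walk \<Rightarrow> walk" where
  "reflect = map (\<lambda>(x, y). (x, - y))"

lemma reflect_reflect [simp]: "reflect (reflect \<omega>) = \<omega>"
  by (simp add: reflect_def comp_def case_prod_unfold)

lemma steps_reflect [simp]: "steps (reflect \<omega>) = steps \<omega>"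
  by (simp add: reflect_def steps_def)

lemma is_SAW_reflect: "is_SAW \<omega> \<Longrightarrow> is_SAW (reflect \<omega>)"
proof -
  have "nearest_neighbors (case u of (x, y) \<Rightarrow> (x, - y)) (case v of (x, y) \<Rightarrow> (x, - y)) = nearest_neighbors u v" for u v
    by (auto simp: nearest_neighbors_def split: prod.splits)
  then show "is_SAW \<omega> \<Longrightarrow> is_SAW (reflect \<omega>)"
    by (auto simp: is_SAW_def reflect_def successively_map distinct_map inj_on_def)
qed

text \<open>
  The cut is at the last visit to the highest level. What comes before is a bridge. What comes
  after stays strictly below its starting level and strictly above \<open>0\<close>; upside down, it is a
  half-plane walk of smaller height. Repeating this decomposes a half-plane walk into bridges of
  strictly decreasing heights.
\<close>

lemma half_plane_split_at_top:
  assumes \<omega>: "\<omega> \<in> half_plane_upto (Suc h)" "\<omega> \<notin> half_plane_upto h"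
  obtains u r where "u \<in> bridges_of_height (Suc h)" "r \<in> half_plane_upto h" "\<omega> = u \<otimes> reflect r"
proof -
  have hp: "half_plane_SAW \<omega>" and le: "\<And>z. z \<in> set \<omega> \<Longrightarrow> snd z \<le> int (Suc h)"
    and "\<exists>z\<in>set \<omega>. snd z = int (Suc h)"
    using \<omega> by (force simp: half_plane_upto_def)+
  then obtain u v where uv: "\<omega> = u \<otimes> v" "from_origin u" "from_origin v" "snd (last u) = int (Suc h)"
      "\<And>z. z \<in> set (tl v) \<Longrightarrow> snd (last u + z) \<noteq> int (Suc h)"
    using split_at_last[OF half_plane_SAW_from_origin[OF hp], of "\<lambda>z. snd z = int (Suc h)"] by metis
  have set_eq: "set \<omega> = set u \<union> (+) (last u) ` set v"
    using uv set_concat from_origin_nonempty by blast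
  have u: "bridge u"
    using half_plane_SAW_prefix hp uv(1-4) le set_eq by (auto simp: bridge_iff)
  have v: "is_SAW v" using hp uv is_SAW_concat_iff[OF from_origin_nonempty] by (auto simp: half_plane_SAW_iff)
  have tl: "snd z < 0 \<and> - int (Suc h) < snd z" if "z \<in> set (tl v)" for z
  proof -
    have "last u + z \<in> set (tl \<omega>)"
      using that uv(1,2) by (auto simp: concat_walk_def from_origin_def)
    then have "0 < snd (last u + z)" "snd (last u + z) \<le> int (Suc h)"
      using hp le[of "last u + z"] by (auto simp: half_plane_SAW_iff list.set_sel(2) from_origin_nonempty)
    then show ?thesis using uv(4) uv(5)[OF that] by simp
  qed
  obtain t where t: "v = 0 # t" using uv(3) by (rule from_originE)
  have r: "half_plane_SAW (reflect v)"
    using tl is_SAW_reflect[OF v] by (auto simp: half_plane_SAW_iff t reflect_def zero_prod_def)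
  have "reflect v \<in> half_plane_upto h"
    using r tl by (fastforce simp: half_plane_upto_def t reflect_def zero_prod_def)
  moreover have "u \<in> bridges_of_height (Suc h)"
    using u uv(4) by (simp add: bridges_of_height_def bridge_height)
  ultimately show thesis using uv(1) by (intro that) auto
qed

lemma half_plane_upto_Suc_weight:
  assumes "0 \<le> z"
  shows "emeasure (walk_weight z) (half_plane_upto (Suc h)) \<le>
    emeasure (walk_weight z) (half_plane_upto h) * (1 + emeasure (walk_weight z) (bridges_of_height (Suc h)))"
proof -
  let ?M = "walk_weight z" and ?D = "half_plane_upto (Suc h) - half_plane_upto h"
  have "ennreal (z ^ 0) * emeasure ?M ?D \<le> emeasure ?M (bridges_of_height (Suc h)) * emeasure ?M (half_plane_upto h)"
  proof (rule walk_weight_factorization_le[where f = "\<lambda>u r. u \<otimes> reflect r", OF assms])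
    fix \<omega> assume "\<omega> \<in> ?D"
    then obtain u r where *: "u \<in> bridges_of_height (Suc h)" "r \<in> half_plane_upto h" "\<omega> = u \<otimes> reflect r"
      using half_plane_split_at_top by blast
    then have "steps \<omega> + 0 = steps u + steps r"
      by (simp add: bridges_of_height_def steps_concat bridge_from_origin from_origin_nonempty)
    with * show "\<exists>u\<in>bridges_of_height (Suc h). \<exists>r\<in>half_plane_upto h.
        \<omega> = u \<otimes> reflect r \<and> steps \<omega> + 0 = steps u + steps r" by blast
  qed
  moreover have "half_plane_upto h \<subseteq> half_plane_upto (Suc h)"
    by (auto simp: half_plane_upto_def)
  then have "emeasure ?M (half_plane_upto (Suc h)) = emeasure ?M (half_plane_upto h) + emeasure ?M ?D"
    by (subst plus_emeasure) (auto intro!: arg_cong[where f = "emeasure ?M"])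
  ultimately show ?thesis
    by (simp add: distrib_left mult.commute add_left_mono)
qed

text \<open>
  The weight of half-plane walks of height at most \<open>h\<close> is at most \<open>\<Prod>k=1..h. (1 + B\<^sub>k)\<close>, where
  \<open>B\<^sub>k\<close> is the weight of the bridges of height \<open>k\<close>. Since \<open>1 + x \<le> exp x\<close>, the exponential of the
  weight of all bridges is a bound that does not depend on \<open>h\<close>.
\<close>

lemma half_plane_weight_finite:
  assumes z: "0 \<le> z" and fin: "emeasure (walk_weight z) {\<omega>. bridge \<omega>} < \<infinity>"
  shows "emeasure (walk_weight z) {\<omega>. half_plane_SAW \<omega>} < \<infinity>"
proof -
  let ?M = "walk_weight z"
  define b where "b h = measure ?M (bridges_of_height h)" for h
  define B where "B = measure ?M {\<omega>. bridge \<omega>}"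
  have b: "emeasure ?M (bridges_of_height h) = ennreal (b h)" "0 \<le> b h" for h
  proof -
    have "emeasure ?M (bridges_of_height h) \<le> emeasure ?M {\<omega>. bridge \<omega>}"
      by (intro emeasure_mono) (auto simp: bridges_of_height_def)
    then have "emeasure ?M (bridges_of_height h) \<noteq> \<top>" using fin by (auto simp: top_unique)
    then show "emeasure ?M (bridges_of_height h) = ennreal (b h)" "0 \<le> b h"
      by (simp_all add: b_def emeasure_eq_ennreal_measure)
  qed
  have exp_bound: "emeasure ?M (half_plane_upto h) \<le> ennreal (exp (\<Sum>k<h. b (Suc k)))" for h
  proof (induction h)
    case 0
    have "half_plane_upto 0 \<subseteq> {[0]}"
    proof
      fix \<omega> assume \<omega>: "\<omega> \<in> half_plane_upto 0"
      then obtain t where t: "\<omega> = 0 # t"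
        by (elim from_originE[OF half_plane_SAW_from_origin, rotated]) (simp add: half_plane_upto_def)
      with \<omega> show "\<omega> \<in> {[0]}"
        by (cases t) (auto simp: half_plane_upto_def half_plane_SAW_iff)
    qed
    then have "emeasure ?M (half_plane_upto 0) \<le> emeasure ?M {[0]}" by (intro emeasure_mono) auto
    then show ?case by (simp add: steps_def)
  next
    case (Suc h)
    have "1 + ennreal (b (Suc h)) = ennreal (1 + b (Suc h))" using b by simp
    also have "\<dots> \<le> ennreal (exp (b (Suc h)))"
      using b(2)[of "Suc h"] by (intro ennreal_leI exp_ge_add_one_self)
    finally have "emeasure ?M (half_plane_upto (Suc h)) \<le> ennreal (exp (\<Sum>k<h. b (Suc k))) * ennreal (exp (b (Suc h)))"
      using half_plane_upto_Suc_weight[OF z, of h] mult_mono[OF Suc] by (auto simp: b intro: order_trans)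
    then show ?case by (simp add: exp_add flip: ennreal_mult)
  qed
  have sum_le: "(\<Sum>k<h. b (Suc k)) \<le> B" for h
  proof -
    have "ennreal (\<Sum>k<h. b (Suc k)) = (\<Sum>k<h. emeasure ?M (bridges_of_height (Suc k)))"
      using b by (simp add: sum_ennreal)
    also have "\<dots> = emeasure ?M (\<Union>k<h. bridges_of_height (Suc k))"
      by (intro sum_emeasure) (auto simp: disjoint_family_on_def bridges_of_height_def)
    also have "\<dots> \<le> emeasure ?M {\<omega>. bridge \<omega>}"
      by (intro emeasure_mono) (auto simp: bridges_of_height_def)
    also have "\<dots> = ennreal B" using fin by (simp add: B_def emeasure_eq_ennreal_measure)
    finally show ?thesis by (simp add: ennreal_le_iff B_def)
  qed
  have "\<exists>h. \<omega> \<in> half_plane_upto h" if "half_plane_SAW \<omega>" for \<omega>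
  proof
    have "snd z \<le> int (nat (Max (snd ` set \<omega>)))" if "z \<in> set \<omega>" for z
    proof -
      have "snd z \<le> Max (snd ` set \<omega>)" using that by simp
      then show ?thesis by linarith
    qed
    then show "\<omega> \<in> half_plane_upto (nat (Max (snd ` set \<omega>)))"
      using that by (simp add: half_plane_upto_def)
  qed
  then have "{\<omega>. half_plane_SAW \<omega>} = (\<Union>h. half_plane_upto h)"
    by (auto simp: half_plane_upto_def)
  also have "emeasure ?M \<dots> = (SUP h. emeasure ?M (half_plane_upto h))"
    by (intro SUP_emeasure_incseq[symmetric]) (auto simp: incseq_def half_plane_upto_def)
  also have "\<dots> \<le> ennreal (exp B)"
    using exp_bound sum_le by (intro SUP_least) (meson ennreal_leI exp_le_cancel_iff order_trans)
  finally show ?thesis by (simp add: less_top order_le_less_trans)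
qed

text \<open>
  The cut is at the last visit to the lowest level. What follows is a half-plane walk \<open>v\<close>. What
  precedes, read backwards, stays weakly above its starting level; one additional first step
  upwards turns it into a half-plane walk \<open>a\<close>. That step explains the \<open>+ 1\<close>.
\<close>

lemma SAW_split_at_bottom:
  assumes \<omega>: "\<omega> \<in> SAWs"
  obtains a v where "half_plane_SAW a" "half_plane_SAW v"
    "\<omega> = map (\<lambda>z. z - last a) (rev (tl a)) \<otimes> v" "steps \<omega> + 1 = steps a + steps v"
proof -
  have S: "is_SAW \<omega>" "from_origin \<omega>" using \<omega> by (auto simp: is_SAW_def from_origin_def)
  define m where "m = Min (snd ` set \<omega>)"
  have "m \<in> snd ` set \<omega>"
    using from_origin_nonempty[OF S(2)] unfolding m_def by (intro Min_in) auto
  then have m: "\<exists>z\<in>set \<omega>. snd z = m" by auto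
  have m': "m \<le> snd z" if "z \<in> set \<omega>" for z using that by (simp add: m_def)
  obtain u v where uv: "\<omega> = u \<otimes> v" "from_origin u" "from_origin v" "snd (last u) = m"
      "\<And>z. z \<in> set (tl v) \<Longrightarrow> snd (last u + z) \<noteq> m"
    using split_at_last[OF S(2) m] by metis
  note une = from_origin_nonempty[OF uv(2)]
  have SAW: "is_SAW u" "is_SAW v" using S(1) uv is_SAW_concat_iff[OF une] by auto
  have set_eq: "set \<omega> = set u \<union> (+) (last u) ` set v"
    using uv(1) set_concat[OF une uv(3)] by simp
  have v: "half_plane_SAW v"
  proof -
    have "0 < snd z" if "z \<in> set (tl v)" for z
    proof -
      have "last u + z \<in> set \<omega>" using that set_eq uv(3) by (auto simp: from_origin_def list.set_sel(2))
      then show ?thesis using m'[of "last u + z"] uv(4) uv(5)[OF that] by simp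
    qed
    then show ?thesis using SAW uv by (simp add: half_plane_SAW_iff)
  qed
  \<comment> \<open>This translation moves the lowest vertex \<open>last u\<close> to the end of the additional first step.\<close>
  let ?s = "\<lambda>z. ((0, 1) - last u) + z"
  define a where "a = 0 # map ?s (rev u)"
  have up: "0 < snd (?s z)" if "z \<in> set u" for z
    using m'[of z] that set_eq uv(4) by simp
  have "is_SAW (rev u)"
    using SAW(1) nearest_neighbors_commute by (simp add: is_SAW_def successively_rev)
  then have "is_SAW (map ?s (rev u))" by (simp only: is_SAW_translate)
  moreover have "hd (map ?s (rev u)) = (0, 1)" using une by (simp add: hd_map hd_rev)
  moreover have "0 \<notin> set (map ?s (rev u))"
  proof
    assume "0 \<in> set (map ?s (rev u))"
    then obtain z where "z \<in> set u" "?s z = 0" by (auto simp: image_iff)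
    then show False using up[of z] by (metis less_irrefl snd_zero)
  qed
  ultimately have "is_SAW a"
    using une by (auto simp: a_def is_SAW_def successively_Cons nearest_neighbors_def)
  then have a: "half_plane_SAW a" using up by (auto simp: half_plane_SAW_iff a_def)
  have "last a = (0, 1) - last u"
    using une uv(2) by (simp add: a_def last_map last_rev from_origin_def)
  then have "map (\<lambda>z. z - last a) (rev (tl a)) = u"
    by (simp add: a_def rev_map comp_def)
  moreover have "steps \<omega> + 1 = steps a + steps v"
    using uv(1) une by (cases u) (simp_all add: steps_concat, simp add: a_def steps_def)
  ultimately show thesis using that[OF a v] uv(1) by simp
qed

lemma SAWs_weight_le:
  assumes "0 \<le> z"
  shows "ennreal z * emeasure (walk_weight z) SAWs \<le>
    emeasure (walk_weight z) {\<omega>. half_plane_SAW \<omega>} * emeasure (walk_weight z) {\<omega>. half_plane_SAW \<omega>}"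
proof -
  have "ennreal (z ^ 1) * emeasure (walk_weight z) SAWs \<le>
    emeasure (walk_weight z) {\<omega>. half_plane_SAW \<omega>} * emeasure (walk_weight z) {\<omega>. half_plane_SAW \<omega>}"
  proof (rule walk_weight_factorization_le[where f = "\<lambda>a v. map (\<lambda>z. z - last a) (rev (tl a)) \<otimes> v", OF assms])
    fix \<omega> assume "\<omega> \<in> SAWs"
    then obtain a v where "half_plane_SAW a" "half_plane_SAW v"
        "\<omega> = map (\<lambda>z. z - last a) (rev (tl a)) \<otimes> v" "steps \<omega> + 1 = steps a + steps v"
      by (rule SAW_split_at_bottom)
    then show "\<exists>a\<in>{\<omega>. half_plane_SAW \<omega>}. \<exists>v\<in>{\<omega>. half_plane_SAW \<omega>}.
        \<omega> = map (\<lambda>z. z - last a) (rev (tl a)) \<otimes> v \<and> steps \<omega> + 1 = steps a + steps v"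
      by blast
  qed
  then show ?thesis by simp
qed

text \<open>
  Otherwise the half-plane walks, and then all walks, would have finite weight at \<open>beta_c\<close>.
\<close>

lemma bridges_weight_critical: "emeasure (walk_weight beta_c) {\<omega>. bridge \<omega>} = \<infinity>"
proof (rule ccontr)
  let ?H = "emeasure (walk_weight beta_c) {\<omega>. half_plane_SAW \<omega>}"
  assume "emeasure (walk_weight beta_c) {\<omega>. bridge \<omega>} \<noteq> \<infinity>"
  then have "?H < \<infinity>" using half_plane_weight_finite beta_c_pos by (auto simp: less_top)
  then have "?H * ?H < \<infinity>" by (simp add: ennreal_mult_less_top)
  moreover have "ennreal beta_c * \<infinity> \<le> ?H * ?H"
    using SAWs_weight_le[of beta_c] beta_c_pos by (simp add: SAWs_weight_critical)
  ultimately show False using beta_c_pos by (simp add: ennreal_mult_top)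
qed

section \<open>Kesten's identity\<close>

text \<open>
  By unique factorization, the weight of these bridges is the \<open>m\<close>-th power of the weight of the
  irreducible bridges; the two inequalities are proved separately because they are used at different
  values of \<open>z\<close>.
\<close>

definition bridges_with_factors :: "nat \<Rightarrow> walk set" where
  "bridges_with_factors m = concat_list ` {\<omega>s. set \<omega>s \<subseteq> irreducibles \<and> length \<omega>s = m}"

lemma bridges_with_factors_Suc:
  "bridges_with_factors (Suc m) = (\<lambda>(x, y). x \<otimes> y) ` (irreducibles \<times> bridges_with_factors m)"
proof -
  have "{\<omega>s. set \<omega>s \<subseteq> irreducibles \<and> length \<omega>s = Suc m} =
      (\<lambda>(x, xs). x # xs) ` (irreducibles \<times> {\<omega>s. set \<omega>s \<subseteq> irreducibles \<and> length \<omega>s = m})"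
    by (auto simp: length_Suc_conv image_iff)
  then show ?thesis unfolding bridges_with_factors_def by (force simp: image_iff)
qed

lemma bridges_with_factors_bridge: "\<omega> \<in> bridges_with_factors m \<Longrightarrow> bridge \<omega>"
  by (auto simp: bridges_with_factors_def bridge_concat_list)

lemma bridges_with_factors_weight_le:
  assumes "0 \<le> z"
  shows "emeasure (walk_weight z) (bridges_with_factors m) \<le> emeasure (walk_weight z) irreducibles ^ m"
proof (induction m)
  case 0
  have "bridges_with_factors 0 = {[0]}" by (auto simp: bridges_with_factors_def)
  then show ?case by (simp add: steps_def)
next
  case (Suc m)
  have "ennreal (z ^ 0) * emeasure (walk_weight z) (bridges_with_factors (Suc m)) \<le>
      emeasure (walk_weight z) irreducibles * emeasure (walk_weight z) (bridges_with_factors m)"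
  proof (rule walk_weight_factorization_le[where f = "(\<otimes>)", OF assms])
    fix \<omega> assume "\<omega> \<in> bridges_with_factors (Suc m)"
    then obtain x y where *: "x \<in> irreducibles" "y \<in> bridges_with_factors m" "\<omega> = x \<otimes> y"
      by (auto simp: bridges_with_factors_Suc)
    then have "steps \<omega> + 0 = steps x + steps y"
      by (simp add: steps_concat irreducible_bridgeD(2) from_origin_nonempty)
    with * show "\<exists>x\<in>irreducibles. \<exists>y\<in>bridges_with_factors m. \<omega> = x \<otimes> y \<and> steps \<omega> + 0 = steps x + steps y"
      by blast
  qed
  also have "\<dots> \<le> emeasure (walk_weight z) irreducibles ^ Suc m"
    using Suc by (simp add: mult_left_mono)
  finally show ?case by simp
qed

lemma bridges_with_factors_weight_ge:
  assumes "0 \<le> z"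
  shows "emeasure (walk_weight z) irreducibles ^ m \<le> emeasure (walk_weight z) (bridges_with_factors m)"
proof (induction m)
  case 0
  have "bridges_with_factors 0 = {[0]}" by (auto simp: bridges_with_factors_def)
  then show ?case by (simp add: steps_def)
next
  case (Suc m)
  have "emeasure (walk_weight z) irreducibles ^ Suc m \<le>
      emeasure (walk_weight z) irreducibles * emeasure (walk_weight z) (bridges_with_factors m)"
    using Suc by (simp add: mult_left_mono)
  also have "\<dots> \<le> emeasure (walk_weight z) (bridges_with_factors (Suc m))"
  proof (rule walk_weight_product_le[where f = "(\<otimes>)", OF assms])
    show "inj_on (\<lambda>(x, y). x \<otimes> y) (irreducibles \<times> bridges_with_factors m)"
      by (rule inj_onI, clarify) (use irreducible_cancel bridges_with_factors_bridge in blast)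
  qed (auto simp: bridges_with_factors_Suc steps_concat irreducible_bridgeD(2) from_origin_nonempty)
  finally show ?case .
qed

text \<open>
  If the irreducible bridges had weight less than \<open>1\<close>, then the bridges, being products of them,
  would have a weight bounded by a convergent geometric series.
\<close>

lemma irreducibles_weight_ge_1: "1 \<le> emeasure (walk_weight beta_c) irreducibles"
proof (rule ccontr)
  let ?M = "walk_weight beta_c"
  assume "\<not> 1 \<le> emeasure ?M irreducibles"
  then obtain i where i: "emeasure ?M irreducibles = ennreal i" "0 \<le> i" "i < 1"
    by (cases "emeasure ?M irreducibles") (auto simp: not_le)
  have "{\<omega>. bridge \<omega>} \<subseteq> (\<Union>m. bridges_with_factors m)"
  proof
    fix \<omega> assume "\<omega> \<in> {\<omega>. bridge \<omega>}"
    then obtain \<omega>s where "set \<omega>s \<subseteq> irreducibles" "\<omega> = concat_list \<omega>s"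
      using bridge_factorization by blast
    then have "\<omega> \<in> bridges_with_factors (length \<omega>s)" by (auto simp: bridges_with_factors_def)
    then show "\<omega> \<in> (\<Union>m. bridges_with_factors m)" by blast
  qed
  then have "emeasure ?M {\<omega>. bridge \<omega>} \<le> emeasure ?M (\<Union>m. bridges_with_factors m)"
    by (intro emeasure_mono) auto
  also have "\<dots> \<le> (\<Sum>m. emeasure ?M (bridges_with_factors m))"
    by (intro emeasure_subadditive_countably) auto
  also have "\<dots> \<le> (\<Sum>m. ennreal (i ^ m))"
    using bridges_with_factors_weight_le[of beta_c] beta_c_pos i
    by (intro suminf_le) (auto simp: ennreal_power)
  also have "\<dots> = ennreal (\<Sum>m. i ^ m)"
    using i by (intro suminf_ennreal2) (auto intro: summable_geometric)
  finally show False by (simp add: bridges_weight_critical top_unique)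
qed

text \<open>
  The powers of the weight of the irreducible bridges are bounded by the finite weight of all
  walks.
\<close>

lemma irreducibles_weight_subcritical:
  assumes z: "0 \<le> z" "z < beta_c"
  shows "emeasure (walk_weight z) irreducibles \<le> 1"
proof (rule ccontr)
  let ?I = "emeasure (walk_weight z) irreducibles" and ?X = "emeasure (walk_weight z) SAWs"
  assume gt: "\<not> ?I \<le> 1"
  have le: "?I ^ m \<le> ?X" for m
  proof -
    have "?I ^ m \<le> emeasure (walk_weight z) (bridges_with_factors m)"
      using bridges_with_factors_weight_ge[OF z(1)] .
    also have "\<dots> \<le> ?X"
      using bridges_with_factors_bridge half_plane_SAWs_subset
      by (intro emeasure_mono) (auto simp: bridge_iff)
    finally show ?thesis .
  qed
  have fin: "?X < \<infinity>" using SAWs_weight_subcritical[OF z] .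
  then obtain c where c: "?X = ennreal c" "0 \<le> c" by (cases ?X) auto
  have "?I < \<infinity>" using le[of 1] fin by simp
  then obtain i where i: "?I = ennreal i" "0 \<le> i" by (cases ?I) auto
  have "1 < i" using gt i by (simp add: not_le)
  then obtain m where "c < i ^ m" using real_arch_pow by blast
  moreover have "i ^ m \<le> c" using le[of m] i c by (simp add: ennreal_power ennreal_le_iff)
  ultimately show False by simp
qed

text \<open>
  Kesten's identity. The upper bound follows from the subcritical one by monotone convergence
  along a sequence increasing to \<open>beta_c\<close>.
\<close>

lemma Kesten_identity: "emeasure (walk_weight beta_c) irreducibles = 1"
proof (rule antisym[OF _ irreducibles_weight_ge_1])
  define z where "z k = beta_c * (1 - 1 / real (Suc k))" for k
  have z: "0 \<le> z k" "z k < beta_c" for k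
    using beta_c_pos by (auto simp: z_def)
  have mono: "incseq z"
    unfolding z_def using beta_c_pos by (intro incseq_SucI mult_left_mono) (auto simp: frac_le)
  have "(\<lambda>k. 1 / real (Suc k)) \<longlonglongrightarrow> 0" using LIMSEQ_inverse_real_of_nat by (simp add: inverse_eq_divide)
  then have lim: "z \<longlonglongrightarrow> beta_c"
    using tendsto_mult_left[OF tendsto_diff[OF tendsto_const], of _ 0 sequentially beta_c 1]
    unfolding z_def by simp
  have "(SUP k. ennreal (z k ^ n)) = ennreal (beta_c ^ n)" for n
  proof (rule LIMSEQ_unique[OF LIMSEQ_SUP])
    show "incseq (\<lambda>k. ennreal (z k ^ n))"
      using mono z by (auto simp: incseq_def intro!: ennreal_leI power_mono)
    show "(\<lambda>k. ennreal (z k ^ n)) \<longlonglongrightarrow> ennreal (beta_c ^ n)"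
      by (intro tendsto_intros lim)
  qed
  then have "emeasure (walk_weight beta_c) irreducibles =
      (\<integral>\<^sup>+\<omega>. (SUP k. ennreal (z k ^ steps \<omega>)) \<partial>count_space irreducibles)"
    by (simp add: walk_weight_sum)
  also have "\<dots> = (SUP k. \<integral>\<^sup>+\<omega>. ennreal (z k ^ steps \<omega>) \<partial>count_space irreducibles)"
    using mono z
    by (intro nn_integral_monotone_convergence_SUP) (auto simp: incseq_def le_fun_def intro!: ennreal_leI power_mono)
  also have "\<dots> = (SUP k. emeasure (walk_weight (z k)) irreducibles)"
    by (simp add: walk_weight_sum)
  also have "\<dots> \<le> 1"
    using irreducibles_weight_subcritical z by (intro SUP_least) auto
  finally show "emeasure (walk_weight beta_c) irreducibles \<le> 1" .
qed

lemma prob_space_Q_measure: "prob_space Q_measure"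
  and emeasure_Q_measure_singleton: "irreducible_bridge \<omega> \<Longrightarrow> emeasure Q_measure {\<omega>} = ennreal (beta_c ^ steps \<omega>)"
  and sets_Q_measure [measurable_cong]: "sets Q_measure = sets (count_space irreducibles)"
  and space_Q_measure: "space Q_measure = irreducibles"
proof -
  have "emeasure Q_measure irreducibles = (\<integral>\<^sup>+\<omega>. emeasure Q_measure {\<omega>} \<partial>count_space irreducibles)"
    by (intro emeasure_countable_singleton) (auto simp: Q_measure_def sets_point_measure)
  also have "\<dots> = (\<integral>\<^sup>+\<omega>. ennreal (beta_c ^ steps \<omega>) \<partial>count_space irreducibles)"
    by (intro nn_integral_cong) (auto simp: Q_measure_def emeasure_point_measure_finite2)
  also have "\<dots> = 1" using Kesten_identity by (simp add: walk_weight_sum)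
  finally show "prob_space Q_measure"
    by (intro prob_spaceI) (simp add: Q_measure_def space_point_measure)
qed (auto simp: Q_measure_def emeasure_point_measure_finite2 sets_point_measure space_point_measure)

section \<open>Cuts of infinite concatenations\<close>

lemma concat_nth:
  assumes "u \<noteq> []" "n \<le> steps u + steps v"
  shows "(u \<otimes> v) ! n = (if n \<le> steps u then u ! n else last u + v ! (n - steps u))"
proof -
  have len: "length u = Suc (steps u)" using assms(1) by (simp add: steps_def)
  show ?thesis
  proof (cases "n \<le> steps u")
    case False
    then obtain k where k: "n = Suc (steps u + k)" by (metis add_Suc_right less_iff_Suc_add not_less)
    with assms(2) have "k < length (tl v)" by (simp add: steps_def)
    then show ?thesis using k len by (simp add: concat_walk_def nth_append nth_tl)
  qed (simp add: concat_walk_def nth_append len)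
qed

lemma half_plane_SAW_nth_pos:
  assumes "half_plane_SAW \<omega>" "0 < j" "j \<le> steps \<omega>"
  shows "0 < snd (\<omega> ! j)"
  using assms by (simp add: half_plane_SAW_def)

locale irreducible_sequence =
  fixes \<omega>s :: "nat \<Rightarrow> walk"
  assumes irreducible: "irreducible_bridge (\<omega>s i)"
begin

lemma iter_concat_eq: "iter_concat \<omega>s m = concat_list (map \<omega>s [0..<m])"
proof (induction m)
  case (Suc m)
  then show ?case using irreducible
    by (simp add: concat_list_append image_subset_iff)
qed simp

lemma iter_concat_add:
  "iter_concat \<omega>s (m + n) = iter_concat \<omega>s m \<otimes> iter_concat (\<lambda>i. \<omega>s (m + i)) n"
proof -
  interpret shift: irreducible_sequence "\<lambda>i. \<omega>s (m + i)"
    by unfold_locales (rule irreducible)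
  have "[m..<m + n] = map (\<lambda>i. m + i) [0..<n]"
    using map_add_upt[of m n] by (simp add: add.commute)
  then have "map \<omega>s [0..<m + n] = map \<omega>s [0..<m] @ map (\<lambda>i. \<omega>s (m + i)) [0..<n]"
    by (simp add: upt_add_eq_append[of 0] comp_def)
  then show ?thesis using irreducible
    by (simp add: iter_concat_eq shift.iter_concat_eq concat_list_append image_subset_iff)
qed

lemma bridge_iter_concat: "bridge (iter_concat \<omega>s m)"
  using irreducible by (simp add: iter_concat_eq bridge_concat_list image_subset_iff)

lemma iter_concat_nonempty [simp]: "iter_concat \<omega>s m \<noteq> []"
  using bridge_iter_concat bridge_from_origin from_origin_nonempty by blast

lemma le_steps_iter_concat: "m \<le> steps (iter_concat \<omega>s m)"
  using length_le_steps_concat_list[of "map \<omega>s [0..<m]"] irreducible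
  by (simp add: iter_concat_eq image_subset_iff)

text \<open>
  Appending factors does not change the vertices that are already there, so every partial product
  that is long enough gives the same vertex.
\<close>

lemma infinite_concat_nth:
  assumes "n \<le> steps (iter_concat \<omega>s m)"
  shows "infinite_concat \<omega>s n = iter_concat \<omega>s m ! n"
proof -
  have *: "iter_concat \<omega>s (j + k) ! n = iter_concat \<omega>s j ! n" if "n \<le> steps (iter_concat \<omega>s j)" for j k
    using that by (simp add: iter_concat_add concat_nth)
  show ?thesis
    using *[OF assms, of "n - m"] *[OF le_steps_iter_concat, of "m - n"]
    by (cases "n \<le> m") (auto simp: infinite_concat_def)
qed

lemma inf_half_plane_SAW_infinite_concat: "inf_half_plane_SAW (infinite_concat \<omega>s)"
proof -
  let ?w = "infinite_concat \<omega>s"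
  have walk: "half_plane_SAW (iter_concat \<omega>s m)" "is_SAW (iter_concat \<omega>s m)" for m
    using bridge_iter_concat[of m] by (auto simp: bridge_iff half_plane_SAW_iff)
  have len: "j \<le> m \<Longrightarrow> j < length (iter_concat \<omega>s m)" for j m
    using le_steps_iter_concat[of m] by (cases "iter_concat \<omega>s m") (auto simp: steps_def)
  have nth: "j \<le> m \<Longrightarrow> ?w j = iter_concat \<omega>s m ! j" for j m
    using infinite_concat_nth[of j m] le_steps_iter_concat[of m] by simp
  have "nearest_neighbors (?w n) (?w (Suc n))" for n
    using walk(2)[of "Suc n"] len[of "Suc n" "Suc n"]
    by (simp add: nth[of _ "Suc n"] is_SAW_def successively_conv_nth del: iter_concat.simps)
  moreover have "inj ?w"
  proof (rule injI)
    fix i j assume "?w i = ?w j"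
    then have "iter_concat \<omega>s (max i j) ! i = iter_concat \<omega>s (max i j) ! j"
      using nth[of i "max i j"] nth[of j "max i j"] by simp
    then show "i = j"
      using walk(2)[of "max i j"] len[of i "max i j"] len[of j "max i j"]
      by (simp add: is_SAW_def nth_eq_iff_index_eq)
  qed
  moreover have "?w 0 = 0" by (simp add: infinite_concat_def)
  moreover have "0 < snd (?w j)" if "0 < j" for j
    using half_plane_SAW_nth_pos[OF walk(1) that le_steps_iter_concat] by (simp add: infinite_concat_def)
  ultimately show ?thesis by (simp add: inf_half_plane_SAW_def)
qed

end

definition cut_at :: "walk \<Rightarrow> (nat \<Rightarrow> vertex) \<Rightarrow> bool" where
  "cut_at \<omega> w \<longleftrightarrow> (\<exists>w2. inf_half_plane_SAW w2 \<and> w = concat_inf \<omega> w2)"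

lemma has_cut_iff: "has_cut k w \<longleftrightarrow> (\<exists>\<omega>. bridge \<omega> \<and> height \<omega> = k \<and> cut_at \<omega> w)"
  by (auto simp: has_cut_def cut_at_def)

text \<open>
  Cuts in terms of the single vertices of the walk, which shows that they are measurable events.
\<close>

lemma cut_at_iff:
  assumes w: "inf_half_plane_SAW w" and \<omega>: "\<omega> \<noteq> []"
  shows "cut_at \<omega> w \<longleftrightarrow> (\<forall>n\<le>steps \<omega>. w n = \<omega> ! n) \<and> (\<forall>n>steps \<omega>. snd (last \<omega>) < snd (w n))"
proof
  assume "cut_at \<omega> w"
  then show "(\<forall>n\<le>steps \<omega>. w n = \<omega> ! n) \<and> (\<forall>n>steps \<omega>. snd (last \<omega>) < snd (w n))"
    by (auto simp: cut_at_def concat_inf_def inf_half_plane_SAW_def)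
next
  assume *: "(\<forall>n\<le>steps \<omega>. w n = \<omega> ! n) \<and> (\<forall>n>steps \<omega>. snd (last \<omega>) < snd (w n))"
  let ?s = "steps \<omega>"
  have last: "w ?s = last \<omega>" using * \<omega> by (simp add: last_conv_nth steps_def)
  define w2 where "w2 n = - last \<omega> + w (?s + n)" for n
  have "nearest_neighbors (w2 n) (w2 (Suc n))" for n
    using w unfolding w2_def nearest_neighbors_translate by (simp add: inf_half_plane_SAW_def)
  moreover have "inj w2"
  proof (rule injI)
    fix i j assume "w2 i = w2 j"
    then have "w (?s + i) = w (?s + j)" by (simp add: w2_def)
    moreover have "inj w" using w by (simp add: inf_half_plane_SAW_def)
    ultimately show "i = j" by (auto dest: injD)
  qed
  ultimately have "inf_half_plane_SAW w2"
    using * last by (auto simp: inf_half_plane_SAW_def w2_def)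
  moreover have "w = concat_inf \<omega> w2"
    using * by (auto simp: concat_inf_def w2_def fun_eq_iff)
  ultimately show "cut_at \<omega> w" by (auto simp: cut_at_def)
qed

text \<open>
  The infinite walk has cuts only between its factors. Indeed, a partial product that is longer
  than the bridge \<open>\<omega>\<close> below the cut is \<open>\<omega>\<close> followed by a half-plane walk, and \<open>cut_of_concat_list\<close>
  applies to it.
\<close>

lemma (in irreducible_sequence) cut_at_infinite_concat_iff:
  assumes "bridge \<omega>"
  shows "cut_at \<omega> (infinite_concat \<omega>s) \<longleftrightarrow> (\<exists>m. iter_concat \<omega>s m = \<omega>)"
proof
  assume "\<exists>m. iter_concat \<omega>s m = \<omega>"
  then obtain m where m: "iter_concat \<omega>s m = \<omega>" ..
  interpret shift: irreducible_sequence "\<lambda>i. \<omega>s (m + i)"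
    by unfold_locales (rule irreducible)
  have "infinite_concat \<omega>s n = concat_inf \<omega> (infinite_concat (\<lambda>i. \<omega>s (m + i))) n" for n
  proof (cases "n \<le> steps \<omega>")
    case True
    then show ?thesis using infinite_concat_nth[of n m] m by (simp add: concat_inf_def)
  next
    case False
    define k where "k = n - steps \<omega>"
    have "n \<le> steps \<omega> + steps (iter_concat (\<lambda>i. \<omega>s (m + i)) k)"
      using shift.le_steps_iter_concat[of k] by (simp add: k_def)
    moreover have "\<omega> \<noteq> []" using m by auto
    ultimately have "infinite_concat \<omega>s n = last \<omega> + iter_concat (\<lambda>i. \<omega>s (m + i)) k ! k"
      using infinite_concat_nth[of n "m + k"] iter_concat_add[of m k] m False
      by (simp add: steps_concat concat_nth k_def)
    then show ?thesis using False by (simp add: concat_inf_def infinite_concat_def k_def)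
  qed
  then have "infinite_concat \<omega>s = concat_inf \<omega> (infinite_concat (\<lambda>i. \<omega>s (m + i)))" by blast
  then show "cut_at \<omega> (infinite_concat \<omega>s)"
    using shift.inf_half_plane_SAW_infinite_concat by (auto simp: cut_at_def)
next
  assume "cut_at \<omega> (infinite_concat \<omega>s)"
  then have cut: "\<And>n. n \<le> steps \<omega> \<Longrightarrow> infinite_concat \<omega>s n = \<omega> ! n"
    and above: "\<And>n. n > steps \<omega> \<Longrightarrow> snd (last \<omega>) < snd (infinite_concat \<omega>s n)"
    using cut_at_iff[OF inf_half_plane_SAW_infinite_concat from_origin_nonempty[OF bridge_from_origin[OF assms]]]
    by auto
  let ?m = "steps \<omega>"
  have b: "bridge (iter_concat \<omega>s ?m)" by (rule bridge_iter_concat)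
  obtain u v where uv: "iter_concat \<omega>s ?m = u \<otimes> v" "from_origin u" "from_origin v" "steps u = ?m"
    using split_walk[OF bridge_from_origin[OF b] le_steps_iter_concat] by metis
  note ne = from_origin_nonempty[OF uv(2)] from_origin_nonempty[OF uv(3)] from_origin_nonempty[OF bridge_from_origin[OF assms]]
  have steps: "steps (iter_concat \<omega>s ?m) = ?m + steps v" using uv ne by (simp add: steps_concat)
  have nth: "infinite_concat \<omega>s n = (u \<otimes> v) ! n" if "n \<le> ?m + steps v" for n
    using infinite_concat_nth[of n ?m] that uv(1) steps by simp
  have "u = \<omega>"
  proof (rule nth_equalityI)
    show len: "length u = length \<omega>" using uv(4) ne by (cases u; cases \<omega>) (auto simp: steps_def)
    fix n assume "n < length u"
    then have "n \<le> ?m" using uv(4) by (simp add: steps_def)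
    then show "u ! n = \<omega> ! n" using nth[of n] cut[of n] uv(4) ne by (simp add: concat_nth)
  qed
  have "0 < snd (v ! j)" if "0 < j" "j \<le> steps v" for j
    using above[of "?m + j"] nth[of "?m + j"] that uv(4) ne \<open>u = \<omega>\<close> by (simp add: concat_nth)
  then have "half_plane_SAW v"
    using b uv is_SAW_concat_iff[OF ne(1) uv(3)]
    by (auto simp: half_plane_SAW_def bridge_def from_origin_def)
  then obtain j where "\<omega> = concat_list (take j (map \<omega>s [0..<?m]))" "j \<le> ?m"
    using cut_of_concat_list[of "map \<omega>s [0..<?m]" \<omega> v] uv(1) assms irreducible \<open>u = \<omega>\<close>
    by (auto simp: iter_concat_eq image_subset_iff)
  then show "\<exists>m. iter_concat \<omega>s m = \<omega>"
    by (auto simp: iter_concat_eq take_map)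
qed

text \<open>
  By uniqueness of the factorization, a cut at a given bridge prescribes the first factors of the
  sequence and nothing else.
\<close>

lemma (in irreducible_sequence) cut_at_concat_list_iff:
  assumes "set \<rho>s \<subseteq> irreducibles"
  shows "cut_at (concat_list \<rho>s) (infinite_concat \<omega>s) \<longleftrightarrow> (\<forall>i<length \<rho>s. \<omega>s i = \<rho>s ! i)"
proof -
  have "cut_at (concat_list \<rho>s) (infinite_concat \<omega>s) \<longleftrightarrow> (\<exists>m. map \<omega>s [0..<m] = \<rho>s)"
  proof -
    have "map \<omega>s [0..<m] = \<rho>s" if "concat_list (map \<omega>s [0..<m]) = concat_list \<rho>s" for m
      using concat_list_inject[OF _ assms that] irreducible by (simp add: image_subset_iff)
    then show ?thesis
      unfolding cut_at_infinite_concat_iff[OF bridge_concat_list[OF assms]] iter_concat_eq by blast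
  qed
  also have "\<dots> \<longleftrightarrow> map \<omega>s [0..<length \<rho>s] = \<rho>s"

  proof
    assume "\<exists>m. map \<omega>s [0..<m] = \<rho>s"
    then obtain m where m: "map \<omega>s [0..<m] = \<rho>s" ..
    from arg_cong[OF m, of length] have "m = length \<rho>s" by simp
    with m show "map \<omega>s [0..<length \<rho>s] = \<rho>s" by simp
  qed blast
  also have "\<dots> \<longleftrightarrow> (\<forall>i<length \<rho>s. \<omega>s i = \<rho>s ! i)"
    unfolding list_eq_iff_nth_eq by simp
  finally show ?thesis .
qed

section \<open>Walks across a strip\<close>

definition step_up :: "walk \<Rightarrow> walk" where
  "step_up \<omega> = \<omega> @ [last \<omega> + (0, 1)]"

lemma steps_step_up: "\<omega> \<noteq> [] \<Longrightarrow> steps (step_up \<omega>) = steps \<omega> + 1"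
  by (cases \<omega>) (auto simp: step_up_def steps_def)

lemma inj_step_up: "inj step_up"
  by (auto simp: step_up_def inj_on_def)

text \<open>
  Above a cut the walk stays strictly higher than the bridge, so its next step goes up, and this
  is its first visit to the next level.
\<close>

lemma walk_up_to_cut:
  assumes \<omega>: "bridge \<omega>" and cut: "cut_at \<omega> w"
  shows "walk_up_to (height \<omega> + 1) w = step_up \<omega>"
proof -
  obtain w2 where w2: "inf_half_plane_SAW w2" "w = concat_inf \<omega> w2"
    using cut by (auto simp: cut_at_def)
  have ne: "\<omega> \<noteq> []" using \<omega> bridge_from_origin from_origin_nonempty by blast
  have "nearest_neighbors 0 (w2 1)" "0 < snd (w2 1)"
    using w2(1) by (auto simp: inf_half_plane_SAW_def) (metis One_nat_def)
  then have up: "w2 1 = (0, 1)" by (cases "w2 1") (auto simp: nearest_neighbors_def)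
  have len: "length \<omega> = Suc (steps \<omega>)" using ne by (simp add: steps_def)
  have below: "snd (w n) \<le> height \<omega>" if "n \<le> steps \<omega>" for n
    using that \<omega> w2(2) len by (auto simp: concat_inf_def bridge_iff bridge_height)
  have top: "w (Suc (steps \<omega>)) = last \<omega> + (0, 1)"
    using w2(2) up by (simp add: concat_inf_def)
  have "(LEAST n. snd (w n) = height \<omega> + 1) = Suc (steps \<omega>)"
  proof (rule Least_equality)
    show "snd (w (Suc (steps \<omega>))) = height \<omega> + 1" using top \<omega> by (simp add: bridge_height)
    fix n assume "snd (w n) = height \<omega> + 1"
    then show "Suc (steps \<omega>) \<le> n" using below[of n] by (cases "n \<le> steps \<omega>") auto
  qed
  moreover have "map w [0..<Suc (steps \<omega>)] = \<omega>"
    using len w2(2) by (intro nth_equalityI) (auto simp: concat_inf_def simp del: upt_Suc)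
  ultimately show ?thesis
    using top by (simp add: walk_up_to_def step_up_def)
qed

lemma cut_at_unique:
  assumes "bridge \<omega>" "cut_at \<omega> w" "bridge \<omega>'" "cut_at \<omega>' w" "height \<omega> = height \<omega>'"
  shows "\<omega> = \<omega>'"
proof (rule injD[OF inj_step_up])
  show "step_up \<omega> = step_up \<omega>'"
    using walk_up_to_cut[OF assms(1,2)] walk_up_to_cut[OF assms(3,4)] unfolding assms(5) by simp
qed

text \<open>
  The last step of a walk across the strip leads from height \<open>y - 1\<close> straight up to height \<open>y\<close>.
  Without it, the walk is a bridge of height \<open>y - 1\<close>.
\<close>

lemma strip_SAWs_eq:
  assumes "y > 0"
  shows "strip_SAWs y = step_up ` {\<omega>. bridge \<omega> \<and> height \<omega> = y - 1}"
proof (intro equalityI subsetI)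
  fix \<omega> assume "\<omega> \<in> step_up ` {\<omega>. bridge \<omega> \<and> height \<omega> = y - 1}"
  then obtain \<rho> where \<rho>: "bridge \<rho>" "height \<rho> = y - 1" "\<omega> = step_up \<rho>" by auto
  obtain t where t: "\<rho> = 0 # t" using bridge_from_origin[OF \<rho>(1)] by (rule from_originE)
  have top: "snd (last \<rho>) = y - 1" "\<And>z. z \<in> set \<rho> \<Longrightarrow> snd z \<le> y - 1"
    using \<rho>(1,2) by (auto simp: bridge_iff bridge_height)
  have "last \<rho> + (0, 1) \<notin> set \<rho>"
    using top(1) top(2)[of "last \<rho> + (0, 1)"] by auto
  then have "is_SAW \<omega>"
    using \<rho>(1) unfolding \<rho>(3) is_SAW_def bridge_iff half_plane_SAW_iff step_up_def successively_append_iff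
    by (auto simp: nearest_neighbors_def)
  moreover have "0 < snd (\<omega> ! j) \<and> snd (\<omega> ! j) < y" if "j \<in> {0<..<steps \<omega>}" for j
  proof -
    have j: "0 < j" "j \<le> steps \<rho>" using that \<rho>(3) t by (auto simp: steps_step_up)
    then have "\<omega> ! j = \<rho> ! j" "\<rho> ! j \<in> set \<rho>"
      using \<rho>(3) t by (auto simp: step_up_def nth_append steps_def)
    then show ?thesis using top(2)[of "\<rho> ! j"] half_plane_SAW_nth_pos[OF _ j] \<rho>(1) by (auto simp: bridge_def)
  qed
  ultimately show "\<omega> \<in> strip_SAWs y"
    using top(1) \<rho>(3) t by (auto simp: strip_SAWs_def step_up_def)
next
  fix \<omega> assume \<omega>: "\<omega> \<in> strip_SAWs y"
  then have S: "is_SAW \<omega>" "hd \<omega> = 0" "snd (last \<omega>) = y"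
    and strip: "\<And>j. 0 < j \<Longrightarrow> j < steps \<omega> \<Longrightarrow> 0 < snd (\<omega> ! j) \<and> snd (\<omega> ! j) < y"
    by (auto simp: strip_SAWs_def)
  define \<rho> where "\<rho> = butlast \<omega>"
  define z where "z = last \<omega>"
  have \<omega>_eq: "\<omega> = \<rho> @ [z]" using S(1) by (simp add: \<rho>_def z_def is_SAW_def)
  have "\<rho> \<noteq> []" using S(2,3) assms \<omega>_eq by auto
  then obtain t where t: "\<rho> = 0 # t" using S(2) \<omega>_eq by (cases \<rho>) auto
  have pos: "0 < snd x \<and> snd x < y" if "x \<in> set t" for x
  proof -
    obtain j where "j < length t" "x = t ! j" using \<open>x \<in> set t\<close> by (metis in_set_conv_nth)
    then show ?thesis using strip[of "Suc j"] by (simp add: \<omega>_eq t steps_def nth_append)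
  qed
  have last: "snd (last \<rho>) < y" using pos assms by (auto simp: t)
  have "nearest_neighbors (last \<rho>) z"
    using S(1) \<open>\<rho> \<noteq> []\<close> by (simp add: is_SAW_def \<omega>_eq successively_append_iff)
  then have z: "z = last \<rho> + (0, 1)"
    using last S(3) by (cases z; cases "last \<rho>") (auto simp: nearest_neighbors_def z_def)
  have top: "snd (last \<rho>) = y - 1" using z S(3) by (simp add: z_def)
  have "is_SAW \<rho>" using S(1) \<open>\<rho> \<noteq> []\<close> by (simp add: is_SAW_def \<omega>_eq successively_append_iff)
  then have "bridge \<rho>"
    using pos top assms by (force simp: bridge_iff half_plane_SAW_iff t)
  then show "\<omega> \<in> step_up ` {\<omega>. bridge \<omega> \<and> height \<omega> = y - 1}"
    using top z \<omega>_eq by (auto simp: bridge_height step_up_def image_iff)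
qed

section \<open>The law of the infinite half-plane walk\<close>

abbreviation Q_product :: "(nat \<Rightarrow> walk) measure" where
  "Q_product \<equiv> \<Pi>\<^sub>M n\<in>UNIV. Q_measure"

lemma space_Q_product: "space Q_product = {\<omega>s. \<forall>i. irreducible_bridge (\<omega>s i)}"
  by (auto simp: space_PiM space_Q_measure PiE_iff)

lemma Q_product_irreducible: "\<omega>s \<in> space Q_product \<Longrightarrow> irreducible_sequence \<omega>s"
  by (simp add: space_Q_product irreducible_sequence_def)

lemma measurable_iter_concat [measurable]:
  "(\<lambda>\<omega>s. iter_concat \<omega>s k) \<in> measurable Q_product (count_space UNIV)"
proof (induction k)
  case (Suc k)
  have "(\<lambda>\<omega>s. \<omega> \<otimes> \<omega>s k) \<in> measurable Q_product (count_space UNIV)" for \<omega>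
  proof -
    have "(\<lambda>\<rho>. \<omega> \<otimes> \<rho>) \<in> measurable Q_measure (count_space UNIV)"
      by (simp add: measurable_def sets_Q_measure space_Q_measure Pi_def)
    then show ?thesis by measurable
  qed
  then show ?case unfolding iter_concat.simps
    by (rule measurable_compose_countable[OF _ Suc])
qed simp

lemma measurable_infinite_concat [measurable]:
  "infinite_concat \<in> measurable Q_product inf_half_plane_space"
  unfolding inf_half_plane_space_def
proof (rule measurable_restrict_space2)
  show "infinite_concat \<in> space Q_product \<rightarrow> {w. inf_half_plane_SAW w}"
    using irreducible_sequence.inf_half_plane_SAW_infinite_concat Q_product_irreducible by blast
  have "(\<lambda>\<omega>s n. infinite_concat \<omega>s n) \<in> measurable Q_product (\<Pi>\<^sub>M n\<in>UNIV. count_space UNIV)"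
  proof (rule measurable_PiM_single')
    fix n
    show "(\<lambda>\<omega>s. infinite_concat \<omega>s n) \<in> measurable Q_product (count_space UNIV)"
      unfolding infinite_concat_def
      by (rule measurable_compose[OF measurable_iter_concat]) simp
  qed simp
  then show "infinite_concat \<in> measurable Q_product (\<Pi>\<^sub>M n\<in>UNIV. count_space UNIV)" by simp
qed

interpretation Q_product: product_prob_space "\<lambda>_::nat. Q_measure" UNIV
proof -
  interpret prob_space Q_measure by (rule prob_space_Q_measure)
  show "product_prob_space (\<lambda>_. Q_measure)" by unfold_locales
qed

lemma sets_Q_inf [measurable_cong]: "sets Q_inf = sets inf_half_plane_space"
  and space_Q_inf: "space Q_inf = {w. inf_half_plane_SAW w}"
  by (simp_all add: Q_inf_def inf_half_plane_space_def space_restrict_space space_PiM)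

lemma prob_space_Q_inf: "prob_space Q_inf"
  unfolding Q_inf_def by (rule Q_product.prob_space_distr[OF measurable_infinite_concat])

lemma measurable_vertex [measurable]: "(\<lambda>w. w n) \<in> measurable Q_inf (count_space UNIV)"
proof -
  have "(\<lambda>w. w n) \<in> measurable inf_half_plane_space (count_space UNIV)"
    unfolding inf_half_plane_space_def
    by (intro measurable_restrict_space1 measurable_component_singleton) simp
  then show ?thesis by (simp add: measurable_cong_sets[OF sets_Q_inf refl])
qed

text \<open>
  The number of vertices of the initial segment is random, but takes countably many values; for
  each of them the segment depends on finitely many vertices.
\<close>

lemma measurable_walk_up_to [measurable]: "walk_up_to y \<in> measurable Q_inf (count_space UNIV)"
proof -
  have init: "(\<lambda>w. map w [0..<m]) \<in> measurable Q_inf (count_space UNIV)" for m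
  proof (induction m)
    case (Suc m)
    have "(\<lambda>w. \<omega> @ [w m]) \<in> measurable Q_inf (count_space UNIV)" for \<omega>
      by (rule measurable_compose[OF measurable_vertex[of m]]) simp
    then have "(\<lambda>w. map w [0..<m] @ [w m]) \<in> measurable Q_inf (count_space UNIV)"
      by (rule measurable_compose_countable[OF _ Suc])
    then show ?case by simp
  qed simp
  have "(\<lambda>w. snd (w n) = y) \<in> measurable Q_inf (count_space UNIV)" for n
    by (rule measurable_compose[OF measurable_vertex[of n]]) simp
  then have "(\<lambda>w. Suc (LEAST n. snd (w n) = y)) \<in> measurable Q_inf (count_space UNIV)"
    by (intro measurable_compose[OF measurable_Least]) simp_all
  then have "(\<lambda>w. map w [0..<Suc (LEAST n. snd (w n) = y)]) \<in> measurable Q_inf (count_space UNIV)"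
    by (rule measurable_compose_countable[OF init])
  then show ?thesis by (simp add: walk_up_to_def[abs_def])
qed

definition cut_at_event :: "walk \<Rightarrow> (nat \<Rightarrow> vertex) set" where
  "cut_at_event \<omega> = {w \<in> space Q_inf. cut_at \<omega> w}"

lemma sets_cut_at_event [measurable]:
  assumes "bridge \<omega>"
  shows "cut_at_event \<omega> \<in> sets Q_inf"
proof -
  define A where "A n = (if n \<le> steps \<omega> then {\<omega> ! n} else {z. snd (last \<omega>) < snd z})" for n
  have "cut_at \<omega> w \<longleftrightarrow> (\<forall>n. w n \<in> A n)" if "w \<in> space Q_inf" for w
    using cut_at_iff[of w \<omega>] that from_origin_nonempty[OF bridge_from_origin[OF assms]]
    by (auto simp: space_Q_inf A_def not_le)
  then have "cut_at_event \<omega> = {w \<in> space Q_inf. \<forall>n. w n \<in> A n}"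
    unfolding cut_at_event_def by (rule Collect_cong[OF conj_cong[OF refl]])
  also have "\<dots> \<in> sets Q_inf"
  proof (rule sets.sets_Collect_countable_All)
    fix n
    have "(\<lambda>w. w n) -` A n \<inter> space Q_inf \<in> sets Q_inf"
      by (rule measurable_sets[OF measurable_vertex]) simp
    then show "{w \<in> space Q_inf. w n \<in> A n} \<in> sets Q_inf"
      by (simp add: vimage_def Int_def conj_commute)
  qed
  finally show ?thesis .
qed

text \<open>
  The event prescribes the factors \<open>\<rho>s\<close> of \<open>\<omega>\<close> as the first coordinates of the product space, and
  the weights of these factors multiply to \<open>beta_c ^ steps \<omega>\<close>.
\<close>

lemma emeasure_cut_at_event:
  assumes "bridge \<omega>"
  shows "emeasure Q_inf (cut_at_event \<omega>) = ennreal (beta_c ^ steps \<omega>)"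
proof -
  obtain \<rho>s where \<rho>s: "set \<rho>s \<subseteq> irreducibles" "\<omega> = concat_list \<rho>s"
    using bridge_factorization[OF assms] .
  have irr: "irreducible_bridge (\<rho>s ! i)" if "i < length \<rho>s" for i
    using \<rho>s(1) nth_mem[OF that] by blast
  have "infinite_concat -` cut_at_event \<omega> \<inter> space Q_product =
      {\<omega>s \<in> space Q_product. \<forall>i\<in>{..<length \<rho>s}. \<omega>s i \<in> {\<rho>s ! i}}"
    using irreducible_sequence.cut_at_concat_list_iff[OF Q_product_irreducible \<rho>s(1)]
      measurable_space[OF measurable_infinite_concat]
    by (auto simp: cut_at_event_def \<rho>s(2) Q_inf_def)
  then have "emeasure Q_inf (cut_at_event \<omega>) =
      emeasure Q_product {\<omega>s \<in> space Q_product. \<forall>i\<in>{..<length \<rho>s}. \<omega>s i \<in> {\<rho>s ! i}}"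
    using sets_cut_at_event[OF assms] unfolding Q_inf_def
    by (subst emeasure_distr) (auto simp: Q_inf_def)
  also have "\<dots> = (\<Prod>i<length \<rho>s. emeasure Q_measure {\<rho>s ! i})"
    using irr by (intro Q_product.emeasure_PiM_Collect) (auto simp: sets_Q_measure)
  also have "\<dots> = (\<Prod>i<length \<rho>s. ennreal (beta_c ^ steps (\<rho>s ! i)))"
    using irr by (intro prod.cong refl emeasure_Q_measure_singleton) simp
  also have "\<dots> = ennreal (beta_c ^ (\<Sum>i<length \<rho>s. steps (\<rho>s ! i)))"
    using beta_c_pos by (simp add: prod_ennreal power_sum)
  also have "(\<Sum>i<length \<rho>s. steps (\<rho>s ! i)) = steps \<omega>"
    using steps_concat_list[OF \<rho>s(1)] \<rho>s(2) by (simp add: sum_list_sum_nth atLeast0LessThan)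
  finally show ?thesis .
qed

lemma cut_event_eq: "cut_event k = (\<Union>\<omega>\<in>{\<omega>. bridge \<omega> \<and> height \<omega> = k}. cut_at_event \<omega>)"
  by (auto simp: cut_event_def has_cut_iff cut_at_event_def)

lemma sets_cut_event [measurable]: "cut_event k \<in> sets Q_inf"
  unfolding cut_event_eq by (intro sets.countable_UN'') auto

text \<open>
  A walk has at most one cut at each level, so the events for different bridges are disjoint.
\<close>

lemma emeasure_cut_event:
  "emeasure Q_inf (cut_event k) = emeasure (walk_weight beta_c) {\<omega>. bridge \<omega> \<and> height \<omega> = k}"
proof -
  have "disjoint_family_on cut_at_event {\<omega>. bridge \<omega> \<and> height \<omega> = k}"
    using cut_at_unique by (fastforce simp: disjoint_family_on_def cut_at_event_def)
  then have "emeasure Q_inf (cut_event k) =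
      (\<integral>\<^sup>+\<omega>. emeasure Q_inf (cut_at_event \<omega>) \<partial>count_space {\<omega>. bridge \<omega> \<and> height \<omega> = k})"
    unfolding cut_event_eq by (intro emeasure_UN_countable) auto
  also have "\<dots> = (\<integral>\<^sup>+\<omega>. ennreal (beta_c ^ steps \<omega>) \<partial>count_space {\<omega>. bridge \<omega> \<and> height \<omega> = k})"
    by (intro nn_integral_cong) (simp add: emeasure_cut_at_event)
  finally show ?thesis by (simp add: walk_weight_sum)
qed

lemma cut_event_positive:
  assumes "0 \<le> k"
  shows "0 < measure Q_inf (cut_event k)"
proof -
  interpret prob_space Q_inf by (rule prob_space_Q_inf)
  let ?v = "vertical (nat k)"
  have "0 < ennreal (beta_c ^ nat k)" using beta_c_pos by simp
  also have "\<dots> = emeasure (walk_weight beta_c) {?v}" by (simp add: bridge_vertical)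
  also have "\<dots> \<le> emeasure (walk_weight beta_c) {\<omega>. bridge \<omega> \<and> height \<omega> = k}"
    using assms by (intro emeasure_mono) (auto simp: bridge_vertical)
  also have "\<dots> = ennreal (measure Q_inf (cut_event k))"
    by (simp add: emeasure_cut_event[symmetric] emeasure_eq_measure)
  finally show ?thesis by simp
qed

text \<open>
  Given a cut at level \<open>y - 1\<close>, the walk up to height \<open>y\<close> is the bridge below the cut followed by
  one step up; \<open>butlast\<close> recovers the bridge.
\<close>

lemma cut_event_walk_up_to:
  assumes "y > 0"
  shows "cut_event (y - 1) \<inter> {w. walk_up_to y w = \<omega>} =
    (if \<omega> \<in> strip_SAWs y then cut_at_event (butlast \<omega>) else {})"
proof -
  have up: "walk_up_to y w = step_up \<rho>" if "bridge \<rho>" "height \<rho> = y - 1" "w \<in> cut_at_event \<rho>" for \<rho> w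
    using walk_up_to_cut[of \<rho> w] that by (simp add: cut_at_event_def)
  show ?thesis
  proof (cases "\<omega> \<in> strip_SAWs y")
    case True
    then obtain \<rho> where \<rho>: "bridge \<rho>" "height \<rho> = y - 1" "\<omega> = step_up \<rho>"
      by (auto simp: strip_SAWs_eq[OF assms])
    have "cut_event (y - 1) \<inter> {w. walk_up_to y w = \<omega>} = cut_at_event \<rho>"
      using \<rho> up inj_step_up by (auto simp: cut_event_eq inj_eq)
    then show ?thesis using True \<rho>(3) by (simp add: step_up_def)
  next
    case False
    then have "\<omega> \<noteq> step_up \<rho>" if "bridge \<rho>" "height \<rho> = y - 1" for \<rho>
      using that by (auto simp: strip_SAWs_eq[OF assms])
    then show ?thesis using False up by (auto simp: cut_event_eq)
  qed
qed

section \<open>The law of the walk across the strip\<close>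

text \<open>
  Removing the last step identifies the walks across the strip with the bridges of height
  \<open>y - 1\<close>, whose total weight is the probability of the cut event. In particular the sum that
  defines \<open>Z_strip\<close> converges.
\<close>

lemma ennreal_Z_strip:
  assumes "y > 0"
  shows "ennreal (Z_strip y) = ennreal beta_c * emeasure Q_inf (cut_event (y - 1))"
    and "ennreal (Z_strip y) = (\<integral>\<^sup>+\<omega>. ennreal (beta_c ^ steps \<omega>) \<partial>count_space (strip_SAWs y))"
proof -
  interpret prob_space Q_inf by (rule prob_space_Q_inf)
  let ?B = "{\<omega>. bridge \<omega> \<and> height \<omega> = y - 1}" and ?S = "strip_SAWs y"
  have "bij_betw step_up ?B ?S"
    unfolding strip_SAWs_eq[OF assms] by (intro inj_on_imp_bij_betw inj_on_subset[OF inj_step_up]) simp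
  then have "(\<integral>\<^sup>+\<omega>. ennreal (beta_c ^ steps \<omega>) \<partial>count_space ?S) =
      (\<integral>\<^sup>+\<omega>. ennreal (beta_c ^ steps (step_up \<omega>)) \<partial>count_space ?B)"
    by (rule nn_integral_bij_count_space[symmetric])
  also have "\<dots> = (\<integral>\<^sup>+\<omega>. ennreal beta_c * ennreal (beta_c ^ steps \<omega>) \<partial>count_space ?B)"
    using beta_c_pos
    by (intro nn_integral_cong) (auto simp: steps_step_up bridge_from_origin from_origin_nonempty ennreal_mult)
  also have "\<dots> = ennreal beta_c * emeasure Q_inf (cut_event (y - 1))"
    by (simp add: nn_integral_cmult emeasure_cut_event walk_weight_sum)
  finally have total: "(\<integral>\<^sup>+\<omega>. ennreal (beta_c ^ steps \<omega>) \<partial>count_space ?S) =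
      ennreal beta_c * emeasure Q_inf (cut_event (y - 1))" .
  also have fin: "\<dots> < \<infinity>" by (simp add: ennreal_mult_less_top emeasure_eq_measure)
  finally have int: "integrable (count_space ?S) (\<lambda>\<omega>. beta_c ^ steps \<omega>)"
    using beta_c_pos by (intro integrableI_nonneg) auto
  have "Z_strip y = infsetsum (\<lambda>\<omega>. beta_c ^ steps \<omega>) ?S"
    unfolding Z_strip_def using int
    by (intro infsetsum_infsum[symmetric]) (simp add: Infinite_Set_Sum.abs_summable_on_def)
  then have "Z_strip y = integral\<^sup>L (count_space ?S) (\<lambda>\<omega>. beta_c ^ steps \<omega>)"
    by (simp add: infsetsum_def)
  then show Z: "ennreal (Z_strip y) = (\<integral>\<^sup>+\<omega>. ennreal (beta_c ^ steps \<omega>) \<partial>count_space ?S)"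
    using nn_integral_eq_integral[OF int] beta_c_pos by simp
  then show "ennreal (Z_strip y) = ennreal beta_c * emeasure Q_inf (cut_event (y - 1))"
    using total by simp
qed

lemma Z_strip_eq:
  assumes "y > 0"
  shows "Z_strip y = beta_c * measure Q_inf (cut_event (y - 1))" "0 < Z_strip y"
proof -
  interpret prob_space Q_inf by (rule prob_space_Q_inf)
  have pos: "0 < beta_c * measure Q_inf (cut_event (y - 1))"
    using cut_event_positive[of "y - 1"] beta_c_pos assms by simp
  have "ennreal (Z_strip y) = ennreal (beta_c * measure Q_inf (cut_event (y - 1)))"
    using ennreal_Z_strip(1)[OF assms] beta_c_pos by (simp add: emeasure_eq_measure ennreal_mult)
  then show "Z_strip y = beta_c * measure Q_inf (cut_event (y - 1))"
    using pos by (metis ennreal_eq_0_iff ennreal_inj less_eq_real_def linorder_not_le)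
  then show "0 < Z_strip y" using pos by simp
qed

lemma prob_space_Q_strip:
  assumes "y > 0"
  shows "prob_space (Q_strip y)"
proof (rule prob_spaceI)
  have "emeasure (Q_strip y) (strip_SAWs y) = (\<integral>\<^sup>+\<omega>. emeasure (Q_strip y) {\<omega>} \<partial>count_space (strip_SAWs y))"
    by (intro emeasure_countable_singleton) (auto simp: Q_strip_def sets_point_measure)
  also have "\<dots> = (\<integral>\<^sup>+\<omega>. ennreal (beta_c ^ steps \<omega>) * ennreal (1 / Z_strip y) \<partial>count_space (strip_SAWs y))"
    using beta_c_pos Z_strip_eq(2)[OF assms]
    by (intro nn_integral_cong) (auto simp: Q_strip_def emeasure_point_measure_finite2 simp flip: ennreal_mult)
  also have "\<dots> = ennreal (Z_strip y) * ennreal (1 / Z_strip y)"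
    by (simp add: nn_integral_multc ennreal_Z_strip(2)[OF assms])
  also have "\<dots> = 1"
    using Z_strip_eq(2)[OF assms] by (simp flip: ennreal_mult)
  finally show "emeasure (Q_strip y) (space (Q_strip y)) = 1"
    by (simp add: Q_strip_def space_point_measure)
qed

text \<open>
  The intersection is the preimage of \<open>{\<omega>}\<close> under the identity on the strip walks.
\<close>

lemma emeasure_Q_strip_singleton:
  "emeasure (Q_strip y) ({\<omega>} \<inter> strip_SAWs y) =
    (if \<omega> \<in> strip_SAWs y then ennreal (beta_c ^ steps \<omega> / Z_strip y) else 0)"
  by (auto simp: Q_strip_def emeasure_point_measure_finite2)

text \<open>
  If \<open>\<omega>\<close> is \<open>\<rho>\<close> followed by a step up, the left-hand side is \<open>beta_c ^ steps \<rho>\<close> over the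
  probability of the cut event. Multiplying numerator and denominator by
  \<open>beta_c\<close> gives \<open>beta_c ^ steps \<omega> / Z_strip y\<close>.
\<close>

lemma conditional_walk_up_to:
  assumes "y > 0"
  shows "emeasure Q_inf (cut_event (y - 1) \<inter> {w. walk_up_to y w = \<omega>}) / emeasure Q_inf (cut_event (y - 1)) =
    emeasure (Q_strip y) ({\<omega>} \<inter> strip_SAWs y)"
proof -
  interpret prob_space Q_inf by (rule prob_space_Q_inf)
  show ?thesis
  proof (cases "\<omega> \<in> strip_SAWs y")
    case True
    then obtain \<rho> where \<rho>: "bridge \<rho>" "height \<rho> = y - 1" "\<omega> = step_up \<rho>"
      by (auto simp: strip_SAWs_eq[OF assms])
    have "butlast \<omega> = \<rho>" "steps \<omega> = steps \<rho> + 1"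
      using \<rho> by (simp_all add: step_up_def steps_step_up[unfolded step_up_def] bridge_from_origin from_origin_nonempty)
    moreover have "measure Q_inf (cut_at_event \<rho>) = beta_c ^ steps \<rho>"
      using emeasure_cut_at_event[OF \<rho>(1)] beta_c_pos by (simp add: emeasure_eq_measure)
    ultimately have "emeasure Q_inf (cut_event (y - 1) \<inter> {w. walk_up_to y w = \<omega>}) / emeasure Q_inf (cut_event (y - 1)) =
        ennreal (beta_c ^ steps \<rho> / measure Q_inf (cut_event (y - 1)))"
      using True beta_c_pos cut_event_positive[of "y - 1"] assms
      by (simp add: cut_event_walk_up_to emeasure_eq_measure divide_ennreal)
    also have "beta_c ^ steps \<rho> / measure Q_inf (cut_event (y - 1)) = beta_c ^ steps \<omega> / Z_strip y"
      using beta_c_pos \<open>steps \<omega> = steps \<rho> + 1\<close> by (simp add: Z_strip_eq(1)[OF assms])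
    finally show ?thesis using True by (simp only: emeasure_Q_strip_singleton if_True)
  next
    case False
    then show ?thesis by (simp add: cut_event_walk_up_to[OF assms] emeasure_Q_strip_singleton)
  qed
qed

theorem proposition2p10:
  fixes y :: int
  assumes "y > 0"
  shows "prob_space Q_inf \<and> measure Q_inf (cut_event (y - 1)) > 0 \<and> prob_space (Q_strip y) \<and>
    distr (uniform_measure Q_inf (cut_event (y - 1))) (count_space UNIV) (walk_up_to y) =
      distr (Q_strip y) (count_space UNIV) (\<lambda>\<omega>. \<omega>) \<and>
    (\<forall>\<omega>\<in>strip_SAWs y.
      \<P>(w in Q_inf. walk_up_to y w = \<omega> \<bar> has_cut (y - 1) w) = measure (Q_strip y) {\<omega>})"
proof (intro conjI ballI)
  interpret prob_space Q_inf by (rule prob_space_Q_inf)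
  let ?E = "cut_event (y - 1)"
  show "prob_space Q_inf" by (rule prob_space_Q_inf)
  show pos: "0 < measure Q_inf ?E" using cut_event_positive[of "y - 1"] assms by simp
  show "prob_space (Q_strip y)" using assms by (rule prob_space_Q_strip)
  show "distr (uniform_measure Q_inf ?E) (count_space UNIV) (walk_up_to y) =
      distr (Q_strip y) (count_space UNIV) (\<lambda>\<omega>. \<omega>)"
  proof (rule measure_eqI_countable[of _ UNIV])
    fix \<omega>
    let ?A = "walk_up_to y -` {\<omega>} \<inter> space Q_inf"
    have A: "?A \<in> sets Q_inf" by (rule measurable_sets[OF measurable_walk_up_to]) simp
    have "walk_up_to y \<in> measurable (uniform_measure Q_inf ?E) (count_space UNIV)"
      by (simp add: measurable_cong_sets[OF sets_uniform_measure refl] measurable_walk_up_to)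
    then have "emeasure (distr (uniform_measure Q_inf ?E) (count_space UNIV) (walk_up_to y)) {\<omega>} =
        emeasure Q_inf (?E \<inter> ?A) / emeasure Q_inf ?E"
      using A by (subst emeasure_distr) auto
    also have "?E \<inter> ?A = ?E \<inter> {w. walk_up_to y w = \<omega>}" by (auto simp: cut_event_def)
    also have "emeasure Q_inf \<dots> / emeasure Q_inf ?E = emeasure (Q_strip y) ({\<omega>} \<inter> strip_SAWs y)"
      using assms by (rule conditional_walk_up_to)
    also have "\<dots> = emeasure (distr (Q_strip y) (count_space UNIV) (\<lambda>\<omega>. \<omega>)) {\<omega>}"
      by (subst emeasure_distr) (simp_all add: Q_strip_def space_point_measure)
    finally show "emeasure (distr (uniform_measure Q_inf ?E) (count_space UNIV) (walk_up_to y)) {\<omega>} =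
        emeasure (distr (Q_strip y) (count_space UNIV) (\<lambda>\<omega>. \<omega>)) {\<omega>}" .
  qed simp_all
  fix \<omega> assume \<omega>: "\<omega> \<in> strip_SAWs y"
  have "\<P>(w in Q_inf. walk_up_to y w = \<omega> \<bar> has_cut (y - 1) w) =
      measure Q_inf (?E \<inter> {w. walk_up_to y w = \<omega>}) / measure Q_inf ?E"
    unfolding cond_prob_def
    by (intro arg_cong2[where f = "(/)"] arg_cong[where f = "measure Q_inf"]) (auto simp: cut_event_def)
  also have "ennreal \<dots> = emeasure (Q_strip y) ({\<omega>} \<inter> strip_SAWs y)"
    using pos by (simp add: conditional_walk_up_to[OF assms, symmetric] emeasure_eq_measure divide_ennreal)
  also have "{\<omega>} \<inter> strip_SAWs y = {\<omega>}" using \<omega> by simp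
  finally have "enn2real (ennreal (\<P>(w in Q_inf. walk_up_to y w = \<omega> \<bar> has_cut (y - 1) w))) = measure (Q_strip y) {\<omega>}"
    by (simp only: measure_def)
  then show "\<P>(w in Q_inf. walk_up_to y w = \<omega> \<bar> has_cut (y - 1) w) = measure (Q_strip y) {\<omega>}"
    by (simp add: cond_prob_def)
qed

end
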